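(* Let $k=k(r)$ and $n=n(r)$ be sequences of integers with $k(r)\ge2$ and $n=kr$, and suppose that for some $0<\alpha<1$ we have $k=o(n^{1-\alpha})$ as $r\to\infty$. Let $\lambda=k-1$, $\mu_n=\frac12\log^2(\sqrt{n/\lambda})$ and $\sigma_n^2=\frac13\log^3(\sqrt{n/\lambda})$ (with $\sigma_n>0$). For $r\ge1$ let $Y_n=(\log\mathbf{B}-\mu_n)/\sigma_n$, a random variable on the space of $\{0,k\}$-mappings on $n$ nodes with the uniform distribution. Then $Y_n$ converges in distribution to a standard normal distribution as $r\to\infty$. Furthermore, $$\mathbb{P}_n^{\{0,k\}}\left(\log\mathbf{B}\le\mu_n+x\sigma_n\right)=\phi(x)+O\left(\frac{|x|}{\log^{3/4}(\sqrt{n/\lambda})}\right)+O\left(\frac{(\log\log n)^2}{\log^{1/4}(n/\lambda)}\right),$$ where $\phi(x)=\frac{1}{\sqrt{2\pi}}\int_{-\infty}^x e^{-t^2/2}\,dt$.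
   Context: A $\{0,k\}$-mapping on $n$ nodes is a function $f:\{1,\dots,n\}\to\{1,\dots,n\}$ with $|f^{-1}(y)|\in\{0,k\}$ for every $y$. $\mathbf{B}(f)$ is the product of the lengths of all cycles of $f$, counted with multiplicity. $\mathbb{P}_n^{\{0,k\}}$ denotes probability under the uniform distribution on $\{0,k\}$-mappings on $\{1,\dots,n\}$. Asymptotics are as $r\to\infty$. *)

theory Defs
  imports "HOL-Probability.Probability" "HOL-Combinatorics.Orbits" "HOL-Library.Landau_Symbols"
begin

text \<open>The functions from \<open>{1..n}\<close> to itself are represented extensionally, as elements of
  \<open>{1..n} \<rightarrow>\<^sub>E {1..n}\<close>, so that each of them occurs exactly once.\<close>

definition zero_k_mappings :: "nat \<Rightarrow> nat \<Rightarrow> (nat \<Rightarrow> nat) set" where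
  "zero_k_mappings k n =
     {f \<in> {1..n} \<rightarrow>\<^sub>E {1..n}. \<forall>y\<in>{1..n}. card {x \<in> {1..n}. f x = y} \<in> {0, k}}"

definition zero_k_pmf :: "nat \<Rightarrow> nat \<Rightarrow> (nat \<Rightarrow> nat) pmf" where
  "zero_k_pmf k n = pmf_of_set (zero_k_mappings k n)"

text \<open>The product ranges over the set of cycles, not over the set of their lengths: several cycles
  of the same length each contribute a factor.\<close>

definition cycles_of_mapping :: "nat \<Rightarrow> (nat \<Rightarrow> nat) \<Rightarrow> nat set set" where
  "cycles_of_mapping n f = {C. C \<subseteq> {1..n} \<and> cyclic_on f C}"

definition cycle_product :: "nat \<Rightarrow> (nat \<Rightarrow> nat) \<Rightarrow> nat" where
  "cycle_product n f = (\<Prod>C\<in>cycles_of_mapping n f. card C)"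

definition n_over_lambda :: "nat \<Rightarrow> nat \<Rightarrow> real" where
  "n_over_lambda k n = real n / (real k - 1)"

definition mu_n :: "nat \<Rightarrow> nat \<Rightarrow> real" where
  "mu_n k n = (1 / 2) * ln (sqrt (n_over_lambda k n)) ^ 2"

definition sigma_n :: "nat \<Rightarrow> nat \<Rightarrow> real" where
  "sigma_n k n = sqrt ((1 / 3) * ln (sqrt (n_over_lambda k n)) ^ 3)"

definition Y_n :: "nat \<Rightarrow> nat \<Rightarrow> (nat \<Rightarrow> nat) \<Rightarrow> real" where
  "Y_n k n f = (ln (real (cycle_product n f)) - mu_n k n) / sigma_n k n"

definition phi :: "real \<Rightarrow> real" where
  "phi x = 1 / sqrt (2 * pi) * (LBINT t:{..x}. exp (- (t ^ 2) / 2))"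

end

theory Submission
  imports Defs "HOL-Real_Asymp.Real_Asymp"
begin

text \<open>Given the set of cyclic points, of size \<open>Z\<close> say, a uniform \<open>{0,k}\<close>-mapping acts on it as a uniform
  permutation. The proof combines Stein's method for permutations with a tightness estimate for
  \<open>ln Z - ln (sqrt (n / \<lambda>))\<close>.

  Let \<open>W\<^sub>m\<close> be the logarithm of the product of the cycle lengths of a uniform permutation of \<open>m\<close> points.
  Marking a cycle with weight the logarithm of its length gives the exact identity
  \<open>E[W\<^sub>m f(W\<^sub>m)] = (\<Sum>j\<le>m. (ln j / j) E[f(W\<^sub>m\<^sub>-\<^sub>j + ln j)])\<close>, and \<open>W\<^sub>m\<close> is stochastically increasing in \<open>m\<close>, so
  replacing \<open>m - j\<close> by \<open>m\<close> costs at most the difference of the means. A Taylor expansion then bounds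
  the Stein discrepancy of the normalised variable by \<open>O((ln m)\<^sup>-\<^sup>1\<^sup>/\<^sup>2)\<close> for test functions smoothed at a fixed
  scale; smoothing indicators at scale \<open>(ln m)\<^sup>-\<^sup>1\<^sup>/\<^sup>4\<close> yields the Kolmogorov distance.

  For \<open>Z\<close>, exchanging two values of \<open>f\<close> turns the path from a vertex up to its first repetition into a
  cycle. Counting pairs before and after this switching bounds the second moment of \<open>Z\<close> by \<open>2 n / \<lambda>\<close>, and
  bounds the mean number of vertices lying over a cycle of given length by \<open>k E Z\<close>, which excludes small
  values of \<open>Z\<close>.\<close>

section \<open>Cycle lengths of uniform permutations\<close>

text \<open>Tightness of \<open>ln Z\<close> suffices for the following reason. With
  \<open>ell = ln (sqrt (n / \<lambda>))\<close>, an O(1) error in \<open>ln Z\<close> moves the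
  mean \<open>(ln Z)^2 / 2\<close> by O(ell), while the standard deviation has order
  \<open>ell^(3/2)\<close>. The normalised shift is \<open>O(ell^(-1/2))\<close>, no larger than the
  Stein error. Only a first-moment bound for \<open>|ln Z - ell|\<close> enters.

  Small \<open>Z\<close> is the delicate side. If \<open>Z\<close> is at most \<open>z\<close>, all
  \<open>n\<close> vertices lie over cycles of length at most \<open>z\<close>, whereas the mean
  number of such vertices is at most \<open>z k E Z\<close>. As \<open>E Z\<close> has order at most
  \<open>sqrt (n / \<lambda>)\<close>, such mappings have probability
  \<open>O(z / sqrt (n / \<lambda>))\<close>. A logarithmic weight takes the place of the threshold
  \<open>z\<close> below.

  Indicators cannot be used directly, because the derivative of the Stein solution then has a jump.
  A ramp of width \<open>e\<close> has slope \<open>1 / e\<close>, which makes the Stein error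
  \<open>O(1 / (e sqrt ell))\<close>, and replacing the indicator by the ramp costs
  \<open>O(e)\<close>; the choice \<open>e = ell^(-1/4)\<close> balances the two, uniformly in
  \<open>x\<close>.\<close>

text \<open>\<open>cexp m g\<close> is the mean of \<open>g\<close> at the logarithm of the product of the cycle lengths of a
  uniform permutation of \<open>m\<close> points (\<open>sum_permutes_log_cycles\<close> below). The recursion holds because
  the cycle through a fixed point has uniform length \<open>j\<close> and leaves a uniform permutation of the other
  \<open>m - j\<close> points.\<close>

fun cexp :: "nat \<Rightarrow> (real \<Rightarrow> real) \<Rightarrow> real" where
  "cexp 0 g = g 0"
| "cexp (Suc m) g = (\<Sum>i\<le>m. cexp i (\<lambda>w. g (w + ln (real (Suc m - i))))) / real (Suc m)"

text \<open>Clearing the denominator makes the recursion hold for every \<open>m\<close>, with both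
  sides zero at \<open>m = 0\<close>, and indexes it by the length \<open>j\<close> of the first
  cycle.\<close>

lemma cexp_rec: "real m * cexp m g = (\<Sum>j=1..m. cexp (m - j) (\<lambda>w. g (w + ln (real j))))"
proof (cases m)
  case (Suc l)
  have "(\<Sum>i\<le>l. cexp i (\<lambda>w. g (w + ln (real (Suc l - i)))))
      = (\<Sum>j=1..m. cexp (m - j) (\<lambda>w. g (w + ln (real j))))"
    by (rule sum.reindex_bij_witness[of _ "\<lambda>j. m - j" "\<lambda>i. Suc l - i"]) (auto simp: Suc)
  then show ?thesis
    by (simp add: Suc)
qed simp

lemma cexp_linear:
  "cexp m (\<lambda>w. a * f w + b * g w) = a * cexp m f + b * cexp m g"
proof (induction m arbitrary: f g rule: less_induct)
  case (less m)
  show ?case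
  proof (cases m)
    case (Suc l)
    have "(\<Sum>i\<le>l. cexp i (\<lambda>w. a * f (w + ln (real (Suc l - i))) + b * g (w + ln (real (Suc l - i)))))
      = (\<Sum>i\<le>l. a * cexp i (\<lambda>w. f (w + ln (real (Suc l - i)))) + b * cexp i (\<lambda>w. g (w + ln (real (Suc l - i)))))"
      using less Suc by (intro sum.cong) auto
    then show ?thesis
      by (simp add: Suc sum.distrib sum_distrib_left add_divide_distrib)
  qed simp
qed

lemma cexp_const [simp]: "cexp m (\<lambda>w. c) = c"
proof (induction m rule: less_induct)
  case (less m)
  show ?case
  proof (cases m)
    case (Suc l)
    then show ?thesis using less by (simp add: field_simps)
  qed simp
qed

lemma cexp_mono:
  assumes "\<And>w. f w \<le> g w"
  shows "cexp m f \<le> cexp m g"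
  using assms
proof (induction m arbitrary: f g rule: less_induct)
  case (less m)
  show ?case
  proof (cases m)
    case (Suc l)
    have "(\<Sum>i\<le>l. cexp i (\<lambda>w. f (w + ln (real (Suc l - i)))))
        \<le> (\<Sum>i\<le>l. cexp i (\<lambda>w. g (w + ln (real (Suc l - i)))))"
      using less Suc by (intro sum_mono) auto
    then show ?thesis by (simp add: Suc divide_right_mono)
  qed (use less in simp)
qed

lemma cexp_add: "cexp m (\<lambda>w. f w + g w) = cexp m f + cexp m g"
  using cexp_linear[of m 1 f 1 g] by simp

lemma cexp_diff: "cexp m (\<lambda>w. f w - g w) = cexp m f - cexp m g"
  using cexp_linear[of m 1 f "-1" g] by simp

lemma cexp_cmult: "cexp m (\<lambda>w. c * f w) = c * cexp m f"
  using cexp_linear[of m c f 0 f] by simp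

lemma cexp_abs_le:
  assumes "\<And>w. \<bar>f w\<bar> \<le> g w"
  shows "\<bar>cexp m f\<bar> \<le> cexp m g"
proof -
  have "cexp m f \<le> cexp m g" "cexp m (\<lambda>w. (-1) * f w) \<le> cexp m g"
    using assms by (auto intro!: cexp_mono simp: abs_le_iff)
  then show ?thesis unfolding cexp_cmult by (simp add: abs_le_iff)
qed

text \<open>Induction over the first cycle. By the recursion, the factor \<open>w\<close> splits
  into the logarithm of the first cycle and the contribution of the later ones, among which the
  induction hypothesis marks a cycle. After exchanging the two sums, a marked cycle of length
  \<open>i\<close> is the first one with weight \<open>i\<close> and a later one with weight
  \<open>m - i\<close>, which add up to \<open>m\<close>.\<close>

lemma cexp_size_bias:
  "cexp m (\<lambda>w. w * f w) = (\<Sum>j=1..m. ln (real j) / real j * cexp (m - j) (\<lambda>w. f (w + ln (real j))))"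
proof (induction m arbitrary: f rule: less_induct)
  case (less m)
  let ?a = "\<lambda>j. ln (real j)"
  let ?G = "\<lambda>i. cexp (m - i) (\<lambda>w. f (w + ?a i))"
  show ?case
  proof (cases "m = 0")
    case False
    have rec: "cexp (m - j) (\<lambda>w. (w + ?a j) * f (w + ?a j)) = ?a j * ?G j +
        (\<Sum>i=1..m-j. ?a i / real i * cexp (m - i - j) (\<lambda>w. f (w + ?a j + ?a i)))"
      if "j \<in> {1..m}" for j
    proof -
      have "cexp (m - j) (\<lambda>w. (w + ?a j) * f (w + ?a j)) =
         ?a j * ?G j + cexp (m - j) (\<lambda>w. w * f (w + ?a j))"
        by (simp add: cexp_add cexp_cmult distrib_right)
      also have "cexp (m - j) (\<lambda>w. w * f (w + ?a j)) =
        (\<Sum>i=1..m-j. ?a i / real i * cexp (m - j - i) (\<lambda>w. f (w + ?a i + ?a j)))"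
        using that by (intro less[of "m - j" "\<lambda>w. f (w + ?a j)"]) auto
      finally show ?thesis by (simp add: add_ac diff_commute)
    qed
    have inner: "(\<Sum>j=1..m-i. cexp (m - i - j) (\<lambda>w. f (w + ?a j + ?a i))) = real (m - i) * ?G i" for i
      by (subst cexp_rec) simp
    have "real m * cexp m (\<lambda>w. w * f w) = (\<Sum>j=1..m. ?a j * ?G j) +
       (\<Sum>j=1..m. \<Sum>i=1..m-j. ?a i / real i * cexp (m - i - j) (\<lambda>w. f (w + ?a j + ?a i)))"
      unfolding cexp_rec sum.distrib[symmetric] by (intro sum.cong refl rec)
    also have "(\<Sum>j=1..m. \<Sum>i=1..m-j. ?a i / real i * cexp (m - i - j) (\<lambda>w. f (w + ?a j + ?a i)))
      = (\<Sum>i=1..m. \<Sum>j=1..m-i. ?a i / real i * cexp (m - i - j) (\<lambda>w. f (w + ?a j + ?a i)))"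
    proof -
      have dom: "{i \<in> {1..m}. j + i \<le> m} = {1..m - j}" "{i \<in> {1..m}. i + j \<le> m} = {1..m - j}" for j
        by auto
      show ?thesis
        using sum.swap_restrict[of "{1..m}" "{1..m}"
          "\<lambda>j i. ?a i / real i * cexp (m - i - j) (\<lambda>w. f (w + ?a j + ?a i))" "\<lambda>j i. j + i \<le> m"]
        unfolding dom by simp
    qed
    also have "\<dots> = (\<Sum>i=1..m. ?a i / real i * (real (m - i) * ?G i))"
      by (simp only: sum_distrib_left[symmetric] inner)
    also have "(\<Sum>j=1..m. ?a j * ?G j) + \<dots> = real m * (\<Sum>i=1..m. ?a i / real i * ?G i)"
      unfolding sum.distrib[symmetric] sum_distrib_left
      by (intro sum.cong refl) (auto simp: of_nat_diff field_simps)
    finally show ?thesis using False by simp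
  next
    case True
    show ?thesis unfolding True by simp
  qed
qed

lemma cexp_mean: "cexp m (\<lambda>w. w) = (\<Sum>j=1..m. ln (real j) / real j)"
  using cexp_size_bias[of m "\<lambda>_. 1"] unfolding cexp_const mult_1_right .

text \<open>Compare the recursions for \<open>m\<close> and \<open>m + 1\<close> with the same
  remainder \<open>i\<close>: the first cycle is longer by one, which only increases
  \<open>g\<close>. The one extra term, \<open>i = m\<close>, has a first cycle of length 1 and
  equals \<open>cexp m g\<close> because \<open>ln 1 = 0\<close>.\<close>

lemma cexp_mono_size_Suc:
  assumes "mono g"
  shows "cexp m g \<le> cexp (Suc m) g"
proof (cases m)
  case (Suc l)
  have "real m * cexp m g = (\<Sum>i\<le>l. cexp i (\<lambda>w. g (w + ln (real (Suc l - i)))))"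
    by (simp add: Suc)
  also have "\<dots> \<le> (\<Sum>i\<le>l. cexp i (\<lambda>w. g (w + ln (real (Suc (Suc l) - i)))))"
    by (intro sum_mono cexp_mono monoD[OF assms]) auto
  also have "\<dots> + cexp m g = real (Suc m) * cexp (Suc m) g"
    by (simp add: Suc)
  finally have "real (Suc m) * cexp m g \<le> real (Suc m) * cexp (Suc m) g"
    by (simp only: of_nat_Suc distrib_right mult_1 add.commute)
  then show ?thesis by (simp only: mult_le_cancel_left_pos of_nat_0_less_iff zero_less_Suc)
qed simp

lemma cexp_mono_size:
  assumes "mono g" "l \<le> m"
  shows "cexp l g \<le> cexp m g"
  using assms(2) by (induction rule: dec_induct) (auto simp del: cexp.simps intro: order_trans cexp_mono_size_Suc[OF assms(1)])

text \<open>Both \<open>c w + f w\<close> and \<open>c w - f w\<close> are monotone in \<open>w\<close>, so the stochastic monotonicity in the size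
  replaces a coupling of permutations of different sizes.\<close>

lemma cexp_Lipschitz_diff:
  assumes lip: "\<And>u v. \<bar>f u - f v\<bar> \<le> c * \<bar>u - v\<bar>" and "l \<le> m"
  shows "\<bar>cexp l f - cexp m f\<bar> \<le> c * (\<Sum>j=Suc l..m. ln (real j) / real j)"
proof -
  have mono: "mono (\<lambda>w. c * w + s * f w)" if "s = 1 \<or> s = -1" for s
  proof (rule monoI)
    fix u v :: real assume "u \<le> v"
    then show "c * u + s * f u \<le> c * v + s * f v"
      using lip[of u v] that by (auto simp: abs_if algebra_simps split: if_splits)
  qed
  have "(\<Sum>j=1..m. ln (real j) / real j) = (\<Sum>j=1..l. ln (real j) / real j) + (\<Sum>j=Suc l..m. ln (real j) / real j)"
    using sum.ub_add_nat[of 1 l "\<lambda>j. ln (real j) / real j" "m - l"] assms(2) by simp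
  then show ?thesis
    using cexp_mono_size[OF mono[of 1] assms(2)] cexp_mono_size[OF mono[of "-1"] assms(2)]
    unfolding cexp_linear cexp_mean by (auto simp: abs_if algebra_simps)
qed

section \<open>Summation over permutations and their cycles\<close>

definition perm_cycles :: "'a set \<Rightarrow> ('a \<Rightarrow> 'a) \<Rightarrow> 'a set set" where
  "perm_cycles A p = {C. C \<subseteq> A \<and> cyclic_on p C}"

text \<open>Fixed points count: on a singleton the identity is cyclic, in line with
  \<open>perm_cycles\<close>, whose one-point members are the fixed points. They contribute
  \<open>ln 1 = 0\<close> but keep the cycle lengths summing to the size of the set.\<close>

definition cyclic_perms :: "'a set \<Rightarrow> ('a \<Rightarrow> 'a) set" where
  "cyclic_perms C = {t. t permutes C \<and> cyclic_on t C}"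

lemma cyclic_on_nonempty: "cyclic_on f C \<Longrightarrow> C \<noteq> {}"
  by (auto simp: cyclic_on_def)

lemma cyclic_on_disjoint:
  assumes "cyclic_on f C" "cyclic_on f D" "C \<noteq> D"
  shows "C \<inter> D = {}"
  using assms by (metis disjoint_iff orbit_cyclic_eq3)

lemma finite_perm_cycles: "finite A \<Longrightarrow> finite (perm_cycles A p)"
  unfolding perm_cycles_def by (rule finite_subset[of _ "Pow A"]) auto

lemma card_sum_perm_cycles:
  assumes "finite A" "p permutes A"
  shows "(\<Sum>C\<in>perm_cycles A p. card C) = card A"
proof -
  have "\<Union>(perm_cycles A p) = A"
  proof (intro equalityI subsetI)
    fix x assume "x \<in> A"
    then have "x \<in> orbit p x" "orbit p x \<subseteq> A" "cyclic_on p (orbit p x)"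
      using assms permutes_orbit_subset[OF assms(2)] cyclic_on_orbit[OF assms(2,1)]
        permutation_self_in_orbit permutation_permutes by metis+
    then show "x \<in> \<Union>(perm_cycles A p)" unfolding perm_cycles_def by blast
  qed (auto simp: perm_cycles_def)
  moreover have "card (\<Union>(perm_cycles A p)) = (\<Sum>C\<in>perm_cycles A p. card C)"
    using assms(1)
    by (intro card_Union_disjoint)
       (auto simp: perm_cycles_def pairwise_def disjnt_def dest: cyclic_on_disjoint intro: finite_subset)
  ultimately show ?thesis by simp
qed

lemma bij_betw_cyclic_compose:
  assumes "finite A" "C \<subseteq> A"
  shows "bij_betw (\<lambda>(t, s). t \<circ> s) (cyclic_perms C \<times> {s. s permutes A - C})
     {p. p permutes A \<and> cyclic_on p C}"
proof (rule bij_betwI[where g = "\<lambda>p. (perm_restrict p C, perm_restrict p (A - C))"])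
  have restr: "perm_restrict p C permutes C" if "p permutes A" "cyclic_on p C" for p
  proof (rule bij_imp_permutes)
    have inj: "inj_on p C" using that(1) by (metis inj_on_subset permutes_inj subset_UNIV)
    have "p ` C \<subseteq> C" using that(2) cyclic_on_inI by fast
    then have "p ` C = C" using inj finite_cyclic_on[OF that(2)] endo_inj_surj by blast
    then show "bij_betw (perm_restrict p C) C C"
      using inj by (auto simp: bij_betw_def inj_on_def perm_restrict_def)
  qed (auto simp: perm_restrict_def)
  show "(\<lambda>(t, s). t \<circ> s) \<in> cyclic_perms C \<times> {s. s permutes A - C} \<rightarrow> {p. p permutes A \<and> cyclic_on p C}"
  proof safe
    fix t s assume ts: "t \<in> cyclic_perms C" "s permutes A - C"
    show "t \<circ> s permutes A"
      using ts assms(2) by (auto simp: cyclic_perms_def intro!: permutes_compose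
          intro: permutes_subset)
    show "cyclic_on (t \<circ> s) C"
      using ts by (intro permutes_comp_preserves_cyclic1[of s "A - C" t C C]) (auto simp: cyclic_perms_def)
  qed
  show "(\<lambda>p. (perm_restrict p C, perm_restrict p (A - C)))
      \<in> {p. p permutes A \<and> cyclic_on p C} \<rightarrow> cyclic_perms C \<times> {s. s permutes A - C}"
    using restr by (auto simp: cyclic_perms_def cyclic_on_perm_restrict intro: perm_restrict_diff_cyclic)
  show "(case (perm_restrict p C, perm_restrict p (A - C)) of (t, s) \<Rightarrow> t \<circ> s) = p"
    if "p \<in> {p. p permutes A \<and> cyclic_on p C}" for p
    using that assms(2) perm_restrict_union[of p C "A - C"] restr[of p] perm_restrict_diff_cyclic[of p A C]
    by (simp add: Un_absorb1 perm_restrict_id)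
  show "(perm_restrict (case x of (t, s) \<Rightarrow> t \<circ> s) C, perm_restrict (case x of (t, s) \<Rightarrow> t \<circ> s) (A - C)) = x"
    if x0: "x \<in> cyclic_perms C \<times> {s. s permutes A - C}" for x
  proof -
    obtain t s where x: "x = (t, s)" "t permutes C" "s permutes A - C"
      using x0 unfolding cyclic_perms_def by (cases x) auto
    have "perm_restrict (t \<circ> s) C = t"
    proof
      fix y show "perm_restrict (t \<circ> s) C y = t y"
        using x permutes_not_in[OF x(3), of y] permutes_not_in[OF x(2), of y]
        by (auto simp: perm_restrict_def)
    qed
    moreover have "perm_restrict (t \<circ> s) (A - C) = s"
    proof
      fix y show "perm_restrict (t \<circ> s) (A - C) y = s y"
        using x permutes_not_in[OF x(3), of y] permutes_not_in[OF x(2), of "s y"] permutes_in_image[OF x(3), of y]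
        by (auto simp: perm_restrict_def)
    qed
    ultimately show ?thesis by (simp add: x)
  qed
qed

lemma perm_cycles_compose:
  assumes "C \<subseteq> A" "t \<in> cyclic_perms C" "s permutes A - C"
  shows "perm_cycles A (t \<circ> s) = insert C (perm_cycles (A - C) s)" "C \<notin> perm_cycles (A - C) s"
proof -
  have tp: "t permutes C" "cyclic_on t C" using assms(2) by (auto simp: cyclic_perms_def)
  have C: "cyclic_on (t \<circ> s) C"
    using tp assms by (intro permutes_comp_preserves_cyclic1[of s "A - C" t C C]) auto
  have eq: "(t \<circ> s) x = s x" if "x \<in> A - C" for x
    using that permutes_in_image[OF assms(3), of x] permutes_not_in[OF tp(1), of "s x"] by auto
  have iff: "cyclic_on (t \<circ> s) D \<longleftrightarrow> cyclic_on s D" if "D \<subseteq> A - C" for D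
    using eq that by (intro cyclic_cong) auto
  show "perm_cycles A (t \<circ> s) = insert C (perm_cycles (A - C) s)"
  proof (intro equalityI subsetI)
    fix D assume D: "D \<in> perm_cycles A (t \<circ> s)"
    show "D \<in> insert C (perm_cycles (A - C) s)"
    proof (cases "D = C")
      case False
      then have "D \<subseteq> A - C"
        using D C cyclic_on_disjoint[of "t \<circ> s" C D] by (auto simp: perm_cycles_def)
      then show ?thesis using D iff by (auto simp: perm_cycles_def)
    qed simp
  next
    fix D assume "D \<in> insert C (perm_cycles (A - C) s)"
    then show "D \<in> perm_cycles A (t \<circ> s)"
      using C iff assms(1) by (auto simp: perm_cycles_def)
  qed
  show "C \<notin> perm_cycles (A - C) s"
    using cyclic_on_nonempty by (auto simp: perm_cycles_def)
qed

text \<open>Pairs of a permutation and one of its cycles are listed by the cycle first. What remains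
  is a free choice of a cyclic permutation on the cycle and of a permutation of the
  complement.\<close>

lemma sum_permutes_perm_cycles:
  fixes F :: "'a set \<Rightarrow> ('a \<Rightarrow> 'a) \<Rightarrow> real"
  assumes "finite A"
  shows "(\<Sum>p | p permutes A. \<Sum>C\<in>perm_cycles A p. F C p)
    = (\<Sum>C\<in>Pow A - {{}}. \<Sum>t\<in>cyclic_perms C. \<Sum>s | s permutes A - C. F C (t \<circ> s))"
proof -
  have "perm_cycles A p = {C \<in> Pow A - {{}}. cyclic_on p C}" for p
    using cyclic_on_nonempty by (auto simp: perm_cycles_def)
  then have "(\<Sum>p | p permutes A. \<Sum>C\<in>perm_cycles A p. F C p)
    = (\<Sum>C\<in>Pow A - {{}}. \<Sum>p | p \<in> {p. p permutes A} \<and> cyclic_on p C. F C p)"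
    using sum.swap_restrict[of "{p. p permutes A}" "Pow A - {{}}" "\<lambda>p C. F C p" cyclic_on]
      finite_permutations[OF assms] assms by simp
  also have "\<dots> = (\<Sum>C\<in>Pow A - {{}}. \<Sum>t\<in>cyclic_perms C. \<Sum>s | s permutes A - C. F C (t \<circ> s))"
  proof (rule sum.cong[OF refl])
    fix C assume "C \<in> Pow A - {{}}"
    then have "(\<Sum>p | p \<in> {p. p permutes A} \<and> cyclic_on p C. F C p)
      = (\<Sum>x\<in>cyclic_perms C \<times> {s. s permutes A - C}. F C ((\<lambda>(t, s). t \<circ> s) x))"
      using sum.reindex_bij_betw[OF bij_betw_cyclic_compose[OF assms, of C], of "F C"] by simp
    then show "(\<Sum>p | p \<in> {p. p permutes A} \<and> cyclic_on p C. F C p)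
      = (\<Sum>t\<in>cyclic_perms C. \<Sum>s | s permutes A - C. F C (t \<circ> s))"
      by (simp add: sum.cartesian_product case_prod_unfold)
  qed
  finally show ?thesis .
qed

lemma sum_Pow_card:
  fixes h :: "nat \<Rightarrow> real"
  assumes "finite A"
  shows "(\<Sum>C\<in>Pow A - {{}}. h (card C)) = (\<Sum>j=1..card A. real (card A choose j) * h j)"
proof -
  have "(\<Sum>C\<in>Pow A - {{}}. h (card C))
    = (\<Sum>j=1..card A. \<Sum>C | C \<in> Pow A - {{}} \<and> card C = j. h (card C))"
  proof (rule sum.group[symmetric])
    show "card ` (Pow A - {{}}) \<subseteq> {1..card A}"
      by (auto simp: Suc_le_eq card_gt_0_iff finite_subset[OF _ assms] card_mono[OF assms])
  qed (use assms in auto)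
  also have "\<dots> = (\<Sum>j=1..card A. \<Sum>C | C \<subseteq> A \<and> card C = j. h j)"
    by (intro sum.cong) auto
  also have "\<dots> = (\<Sum>j=1..card A. real (card A choose j) * h j)"
    using assms by (simp add: n_subsets)
  finally show ?thesis .
qed

text \<open>Weighting each cycle by its length in the double count yields \<open>m * m!\<close>, which determines the
  number of cyclic permutations of the full set once it is known for all smaller sets.\<close>

lemma card_cyclic_perms:
  assumes "finite C" "C \<noteq> {}"
  shows "card (cyclic_perms C) = fact (card C - 1)"
  using assms
proof (induction "card C" arbitrary: C rule: less_induct)
  case less
  define m where "m = card C"
  have m: "m > 0" using less m_def by (simp add: card_gt_0_iff)
  have "real m * fact m = (\<Sum>p | p permutes C. \<Sum>D\<in>perm_cycles C p. real (card D))"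
    using card_sum_perm_cycles[OF less(2)] card_permutations[OF m_def[symmetric] less(2)]
    by (simp add: m_def flip: of_nat_sum)
  also have "\<dots> = (\<Sum>D\<in>Pow C - {{}}. \<Sum>t\<in>cyclic_perms D. \<Sum>s | s permutes C - D. real (card D))"
    by (rule sum_permutes_perm_cycles[OF less(2)])
  also have "\<dots> = (\<Sum>D\<in>Pow C - {{}}. real (card (cyclic_perms D)) * fact (m - card D) * real (card D))"
  proof (intro sum.cong refl)
    fix D assume D: "D \<in> Pow C - {{}}"
    have "card (C - D) = m - card D"
      using D less(2) by (auto simp: m_def card_Diff_subset finite_subset)
    then show "(\<Sum>t\<in>cyclic_perms D. \<Sum>s | s permutes C - D. real (card D))
      = real (card (cyclic_perms D)) * fact (m - card D) * real (card D)"
      using card_permutations[OF _ finite_Diff[OF less(2)], of D "m - card D"] by simp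
  qed
  also have "\<dots> = real (card (cyclic_perms C)) * real m
     + (\<Sum>D\<in>Pow C - {{}} - {C}. real (card (cyclic_perms D)) * fact (m - card D) * real (card D))"
    using less by (subst sum.remove[of _ C]) (auto simp: m_def)
  also have "(\<Sum>D\<in>Pow C - {{}} - {C}. real (card (cyclic_perms D)) * fact (m - card D) * real (card D))
    = (\<Sum>D\<in>Pow C - {{}} - {C}. fact (card D) * fact (m - card D))"
  proof (intro sum.cong refl)
    fix D assume D: "D \<in> Pow C - {{}} - {C}"
    then have fin: "finite D" using less(2) finite_subset by auto
    have "card D < card C" using D less(2) by (intro psubset_card_mono) auto
    then have "card (cyclic_perms D) = fact (card D - 1)" using D fin by (intro less(1)) auto
    moreover have "card D > 0" using D fin by (simp add: card_gt_0_iff)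
    ultimately show "real (card (cyclic_perms D)) * fact (m - card D) * real (card D)
        = fact (card D) * fact (m - card D)"
      by (simp add: fact_reduce[of "card D"])
  qed
  also have "\<dots> = (\<Sum>D\<in>Pow C - {{}}. fact (card D) * fact (m - card D)) - fact m"
    using less by (subst sum.remove[of "Pow C - {{}}" C]) (auto simp: m_def)
  also have "(\<Sum>D\<in>Pow C - {{}}. fact (card D) * fact (m - card D) :: real)
     = (\<Sum>j=1..m. real (m choose j) * (fact j * fact (m - j)))"
    unfolding m_def by (rule sum_Pow_card[OF less(2)])
  also have "\<dots> = (\<Sum>j=1..m. fact m)"
    by (intro sum.cong refl) (auto simp: binomial_fact)
  finally have "real (card (cyclic_perms C)) * real m = fact m" by simp
  then have "real (card (cyclic_perms C)) = fact (m - 1)"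
    using m by (simp add: fact_reduce[of m])
  then show ?case by (metis m_def of_nat_eq_iff of_nat_fact)
qed

text \<open>As \<open>H\<close> sees only the set of cycles, the cyclic permutation on
  \<open>C\<close> contributes just its count. The weight \<open>b j = j\<close> gives the recursion
  of \<open>cexp\<close>, and \<open>b j = j^2\<close> the second moment of cycle lengths.\<close>

lemma sum_permutes_weighted:
  fixes b :: "nat \<Rightarrow> real" and H :: "'a set set \<Rightarrow> real"
  assumes "finite A"
  shows "(\<Sum>p | p permutes A. (\<Sum>C\<in>perm_cycles A p. b (card C)) * H (perm_cycles A p))
    = (\<Sum>C\<in>Pow A - {{}}. b (card C) * fact (card C - 1) *
        (\<Sum>s | s permutes A - C. H (insert C (perm_cycles (A - C) s))))"
proof -
  have "(\<Sum>p | p permutes A. (\<Sum>C\<in>perm_cycles A p. b (card C)) * H (perm_cycles A p))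
    = (\<Sum>p | p permutes A. \<Sum>C\<in>perm_cycles A p. b (card C) * H (perm_cycles A p))"
    by (simp add: sum_distrib_right)
  also have "\<dots> = (\<Sum>C\<in>Pow A - {{}}. \<Sum>t\<in>cyclic_perms C. \<Sum>s | s permutes A - C.
      b (card C) * H (perm_cycles A (t \<circ> s)))"
    by (rule sum_permutes_perm_cycles[OF assms])
  also have "\<dots> = (\<Sum>C\<in>Pow A - {{}}. \<Sum>t\<in>cyclic_perms C. \<Sum>s | s permutes A - C.
      b (card C) * H (insert C (perm_cycles (A - C) s)))"
    by (intro sum.cong refl) (auto simp: perm_cycles_compose)
  also have "\<dots> = (\<Sum>C\<in>Pow A - {{}}. b (card C) * fact (card C - 1) *
        (\<Sum>s | s permutes A - C. H (insert C (perm_cycles (A - C) s))))"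
    by (intro sum.cong refl)
       (auto simp: card_cyclic_perms finite_subset[OF _ assms] sum_distrib_left mult_ac)
  finally show ?thesis .
qed

text \<open>Weighting cycles by their length multiplies the sum by the constant
  \<open>card A\<close>. Removing the marked cycle of length \<open>j\<close> leaves the coefficient
  \<open>(m choose j) * fact j * fact (m - j) = fact m\<close>, independent of \<open>j\<close>, and
  what results is the recursion of \<open>cexp\<close>.\<close>

lemma sum_permutes_log_cycles:
  fixes g :: "real \<Rightarrow> real"
  assumes "finite A"
  shows "(\<Sum>p | p permutes A. g (\<Sum>C\<in>perm_cycles A p. ln (real (card C)))) = fact (card A) * cexp (card A) g"
  using assms
proof (induction "card A" arbitrary: A g rule: less_induct)
  case less
  define m where "m = card A"
  define H where "H = (\<lambda>S :: 'a set set. g (\<Sum>C\<in>S. ln (real (card C))))"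
  show ?case
  proof (cases "m = 0")
    case True
    then have "A = {}" using less m_def by simp
    moreover have "perm_cycles {} p = {}" for p :: "'a \<Rightarrow> 'a"
      using cyclic_on_nonempty by (auto simp: perm_cycles_def)
    ultimately show ?thesis by simp
  next
    case False
    have "real m * (\<Sum>p | p permutes A. H (perm_cycles A p))
        = (\<Sum>p | p permutes A. (\<Sum>C\<in>perm_cycles A p. real (card C)) * H (perm_cycles A p))"
      using card_sum_perm_cycles[OF less(2)] by (simp add: m_def sum_distrib_left flip: of_nat_sum)
    also have "\<dots> = (\<Sum>C\<in>Pow A - {{}}. real (card C) * fact (card C - 1) *
        (\<Sum>s | s permutes A - C. H (insert C (perm_cycles (A - C) s))))"
      by (rule sum_permutes_weighted[OF less(2)])
    also have "\<dots> = (\<Sum>C\<in>Pow A - {{}}. fact (card C) * (fact (m - card C) *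
        cexp (m - card C) (\<lambda>w. g (w + ln (real (card C))))))"
    proof (intro sum.cong refl)
      fix C assume C: "C \<in> Pow A - {{}}"
      then have fin: "finite C" using less(2) finite_subset by auto
      have pos: "card C > 0" using C fin by (simp add: card_gt_0_iff)
      have card: "card (A - C) = m - card C"
        using C fin by (auto simp: m_def card_Diff_subset)
      have notin: "C \<notin> perm_cycles (A - C) s" for s
        using cyclic_on_nonempty C by (auto simp: perm_cycles_def)
      have "(\<Sum>s | s permutes A - C. H (insert C (perm_cycles (A - C) s)))
        = (\<Sum>s | s permutes A - C. (\<lambda>w. g (w + ln (real (card C)))) (\<Sum>D\<in>perm_cycles (A - C) s. ln (real (card D))))"
        using less(2) notin by (simp add: H_def finite_perm_cycles add.commute)
      also have "\<dots> = fact (card (A - C)) * cexp (card (A - C)) (\<lambda>w. g (w + ln (real (card C))))"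
        using less(2) C by (intro less(1) psubset_card_mono) auto
      finally have "(\<Sum>s | s permutes A - C. H (insert C (perm_cycles (A - C) s)))
         = fact (m - card C) * cexp (m - card C) (\<lambda>w. g (w + ln (real (card C))))"
        by (simp only: card)
      moreover have "real (card C) * fact (card C - 1) = fact (card C)"
        using pos by (simp add: fact_reduce[of "card C"])
      ultimately show "real (card C) * fact (card C - 1) *
        (\<Sum>s | s permutes A - C. H (insert C (perm_cycles (A - C) s)))
        = fact (card C) * (fact (m - card C) * cexp (m - card C) (\<lambda>w. g (w + ln (real (card C)))))"
        by (simp only:)
    qed
    also have "\<dots> = (\<Sum>j=1..m. real (m choose j) * (fact j * (fact (m - j) *
        cexp (m - j) (\<lambda>w. g (w + ln (real j))))))"
      unfolding m_def by (rule sum_Pow_card[OF less(2)])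
    also have "\<dots> = (\<Sum>j=1..m. fact m * cexp (m - j) (\<lambda>w. g (w + ln (real j))))"
      by (intro sum.cong refl) (auto simp: binomial_fact)
    also have "\<dots> = real m * (fact m * cexp m g)"
      by (simp only: sum_distrib_left[symmetric] cexp_rec[symmetric] mult.left_commute)
    finally have "(\<Sum>p | p permutes A. H (perm_cycles A p)) = fact m * cexp m g"
      using False by simp
    then show ?thesis by (simp only: H_def m_def)
  qed
qed

text \<open>The cycle through a given point has uniform length, of mean \<open>(m + 1) / 2\<close>;
  adding over the points counts each cycle with the square of its length.\<close>

lemma sum_permutes_card_sq:
  assumes "finite A"
  shows "(\<Sum>p | p permutes A. \<Sum>C\<in>perm_cycles A p. real (card C) ^ 2)
     = fact (card A) * (real (card A) * (real (card A) + 1) / 2)"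
proof -
  define m where "m = card A"
  have "(\<Sum>p | p permutes A. \<Sum>C\<in>perm_cycles A p. real (card C) ^ 2)
    = (\<Sum>C\<in>Pow A - {{}}. real (card C) ^ 2 * fact (card C - 1) * (\<Sum>s | s permutes A - C. 1))"
    using sum_permutes_weighted[OF assms, of "\<lambda>j. real j ^ 2" "\<lambda>_. 1"] by simp
  also have "\<dots> = (\<Sum>C\<in>Pow A - {{}}. real (card C) * fact (card C) * fact (m - card C))"
  proof (intro sum.cong refl)
    fix C assume C: "C \<in> Pow A - {{}}"
    then have fin: "finite C" using assms finite_subset by auto
    have pos: "card C > 0" using C fin by (simp add: card_gt_0_iff)
    have "card (A - C) = m - card C"
      using C fin by (auto simp: m_def card_Diff_subset)
    then have "(\<Sum>s | s permutes A - C. 1) = (fact (m - card C) :: real)"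
      using card_permutations[OF _ finite_Diff[OF assms], of C "m - card C"] by simp
    moreover have "real (card C) * fact (card C - 1) = fact (card C)"
      using pos by (simp add: fact_reduce[of "card C"])
    ultimately show "real (card C) ^ 2 * fact (card C - 1) * (\<Sum>s | s permutes A - C. 1)
      = real (card C) * fact (card C) * fact (m - card C)"
      by (simp add: power2_eq_square)
  qed
  also have "\<dots> = (\<Sum>j=1..m. real (m choose j) * (real j * fact j * fact (m - j)))"
    unfolding m_def by (rule sum_Pow_card[OF assms])
  also have "\<dots> = (\<Sum>j=1..m. fact m * real j)"
    by (intro sum.cong refl) (auto simp: binomial_fact)
  also have "\<dots> = fact m * (real m * (real m + 1) / 2)"
  proof -
    have "(\<Sum>j=1..m. real j) = real m * (real m + 1) / 2"
      by (induction m) (auto simp: field_simps)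
    then show ?thesis by (simp flip: sum_distrib_left)
  qed
  finally show ?thesis by (simp only: m_def)
qed

section \<open>Stein discrepancy for permutations\<close>

lemma power_diff_bounds:
  fixes a b :: real
  assumes "0 \<le> a" "a \<le> b"
  shows "real (Suc p) * a ^ p * (b - a) \<le> b ^ Suc p - a ^ Suc p"
    and "b ^ Suc p - a ^ Suc p \<le> real (Suc p) * b ^ p * (b - a)"
proof (induction p)
  case (Suc p)
  have split: "b ^ Suc (Suc p) - a ^ Suc (Suc p) = b * (b ^ Suc p - a ^ Suc p) + a ^ Suc p * (b - a)"
    by (simp add: algebra_simps)
  {
    case 1
    have "a * (real (Suc p) * a ^ p * (b - a)) \<le> b * (b ^ Suc p - a ^ Suc p)"
      using assms Suc(1) by (intro mult_mono) auto
    then show ?case unfolding split by (simp add: algebra_simps)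
  next
    case 2
    have "b * (b ^ Suc p - a ^ Suc p) \<le> b * (real (Suc p) * b ^ p * (b - a))"
      using assms Suc(2) by (intro mult_left_mono) auto
    moreover have "a ^ Suc p * (b - a) \<le> b ^ Suc p * (b - a)"
      using assms by (intro mult_right_mono power_mono) auto
    ultimately show ?case unfolding split by (simp add: algebra_simps)
  }
qed auto

lemma ln_Suc_diff_bounds:
  assumes "m \<ge> 1"
  shows "1 / real (Suc m) \<le> ln (real (Suc m)) - ln (real m)" "ln (real (Suc m)) - ln (real m) \<le> 1 / real m"
proof -
  have pos: "real m > 0" "real (Suc m) > 0" using assms by auto
  have "ln (real m / real (Suc m)) \<le> real m / real (Suc m) - 1"
    using pos by (intro ln_le_minus_one) simp
  also have "\<dots> = - (1 / real (Suc m))" by (simp add: field_simps)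
  finally show "1 / real (Suc m) \<le> ln (real (Suc m)) - ln (real m)"
    using pos by (simp add: ln_div)
  have "ln (real (Suc m) / real m) \<le> real (Suc m) / real m - 1"
    using pos by (intro ln_le_minus_one) simp
  also have "\<dots> = 1 / real m" using pos by (simp add: field_simps)
  finally show "ln (real (Suc m)) - ln (real m) \<le> 1 / real m"
    using pos by (simp add: ln_div)
qed

text \<open>The function \<open>(ln x)^(p + 1) / x\<close> is not monotone, so the comparison of the
  sum with its integral carries the correction \<open>ln m ^ (p + 1)\<close>. The exponent
  \<open>Suc p\<close> makes the summand at \<open>j = 1\<close> vanish.\<close>

lemma sum_ln_power_div_upper:
  assumes "m \<ge> 1"
  shows "(\<Sum>j=1..m. ln (real j) ^ Suc p / real j) \<le> ln (real m) ^ Suc (Suc p) / real (Suc (Suc p)) + ln (real m) ^ Suc p"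
  using assms
proof (induction m rule: nat_induct_at_least)
  case (Suc m)
  define a b d where "a = ln (real m)" and "b = ln (real (Suc m))" and "d = 1 / real (Suc m)"
  have ab: "0 \<le> a" "a \<le> b" using Suc by (auto simp: a_def b_def)
  have "b ^ Suc p * d = a ^ Suc p * d + (b ^ Suc p - a ^ Suc p) * d" by (simp add: algebra_simps)
  \<comment> \<open>The crude bound \<open>d <= 1\<close> lets this error telescope into the
    correction term.\<close>
  also have "(b ^ Suc p - a ^ Suc p) * d \<le> (b ^ Suc p - a ^ Suc p) * 1"
    using power_mono[OF ab(2,1), of "Suc p"] by (intro mult_left_mono) (auto simp: d_def)
  also have "a ^ Suc p * d \<le> a ^ Suc p * (b - a)"
    using ln_Suc_diff_bounds(1)[OF Suc(1)] ab by (intro mult_left_mono) (auto simp: a_def b_def d_def)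
  also have "\<dots> \<le> (b ^ Suc (Suc p) - a ^ Suc (Suc p)) / real (Suc (Suc p))"
    using power_diff_bounds(1)[OF ab, of "Suc p"] by (simp add: field_simps)
  finally have "b ^ Suc p * d \<le> (b ^ Suc (Suc p) - a ^ Suc (Suc p)) / real (Suc (Suc p)) + (b ^ Suc p - a ^ Suc p)"
    by simp
  then have "(a ^ Suc (Suc p) / real (Suc (Suc p)) + a ^ Suc p) + b ^ Suc p * d
      \<le> b ^ Suc (Suc p) / real (Suc (Suc p)) + b ^ Suc p"
    unfolding diff_divide_distrib by linarith
  moreover have "(\<Sum>j=1..Suc m. ln (real j) ^ Suc p / real j)
      = (\<Sum>j=1..m. ln (real j) ^ Suc p / real j) + b ^ Suc p * d"
    by (simp add: b_def d_def)
  ultimately show ?case using Suc(2) unfolding a_def[symmetric] b_def[symmetric] by linarith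
qed simp

lemma sum_ln_power_div_lower:
  assumes "m \<ge> 1"
  shows "ln (real m) ^ Suc (Suc p) / real (Suc (Suc p)) - ln (real m) ^ Suc p \<le> (\<Sum>j=1..m. ln (real j) ^ Suc p / real j)"
proof -
  \<comment> \<open>The correction keeps the fixed upper end \<open>m\<close>, and its weight
    \<open>1 - 1 / l\<close> telescopes through the differences
    \<open>1 / l - 1 / (l + 1)\<close>.\<close>
  have "ln (real l) ^ Suc (Suc p) / real (Suc (Suc p))
      \<le> (\<Sum>j=1..l. ln (real j) ^ Suc p / real j) + ln (real m) ^ Suc p * (1 - 1 / real l)"
    if "1 \<le> l" "l \<le> m" for l
    using that
  proof (induction l rule: nat_induct_at_least)
    case (Suc l)
    define a b where "a = ln (real l)" and "b = ln (real (Suc l))"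
    have ab: "0 \<le> a" "a \<le> b" using Suc by (auto simp: a_def b_def)
    have bm: "b \<le> ln (real m)" using Suc by (simp add: b_def)
    have "(b ^ Suc (Suc p) - a ^ Suc (Suc p)) / real (Suc (Suc p)) \<le> b ^ Suc p * (b - a)"
      using power_diff_bounds(2)[OF ab, of "Suc p"] by (simp add: field_simps)
    also have "\<dots> \<le> b ^ Suc p * (1 / real l)"
      using ln_Suc_diff_bounds(2)[OF Suc(1)] ab by (intro mult_left_mono) (auto simp: a_def b_def)
    also have "1 / real l = 1 / real (Suc l) + (1 / real l - 1 / real (Suc l))" by simp
    also have "b ^ Suc p * \<dots> = b ^ Suc p / real (Suc l) + b ^ Suc p * (1 / real l - 1 / real (Suc l))"
      by (simp add: algebra_simps)
    also have "b ^ Suc p * (1 / real l - 1 / real (Suc l)) \<le> ln (real m) ^ Suc p * (1 / real l - 1 / real (Suc l))"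
      using ab bm Suc(1) by (intro mult_right_mono power_mono) (auto simp: field_simps)
    finally have "(b ^ Suc (Suc p) - a ^ Suc (Suc p)) / real (Suc (Suc p))
       \<le> b ^ Suc p / real (Suc l) + ln (real m) ^ Suc p * (1 / real l - 1 / real (Suc l))" by simp
    then have "b ^ Suc (Suc p) / real (Suc (Suc p))
       \<le> a ^ Suc (Suc p) / real (Suc (Suc p)) + b ^ Suc p / real (Suc l)
         + ln (real m) ^ Suc p * (1 / real l - 1 / real (Suc l))"
      unfolding diff_divide_distrib by linarith
    moreover have "a ^ Suc (Suc p) / real (Suc (Suc p))
      \<le> (\<Sum>j=1..l. ln (real j) ^ Suc p / real j) + ln (real m) ^ Suc p * (1 - 1 / real l)"
      using Suc(2,3) by (simp add: a_def)
    ultimately show ?case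
      by (simp add: b_def algebra_simps)
  qed simp
  from this[of m] have "ln (real m) ^ Suc (Suc p) / real (Suc (Suc p))
      \<le> (\<Sum>j=1..m. ln (real j) ^ Suc p / real j) + ln (real m) ^ Suc p * (1 - 1 / real m)"
    using assms by simp
  also have "ln (real m) ^ Suc p * (1 - 1 / real m) \<le> ln (real m) ^ Suc p * 1"
    using assms by (intro mult_left_mono) auto
  finally show ?thesis by simp
qed

text \<open>On the range of summation \<open>i + j > m\<close>, so
  \<open>1 / (i j) = (1 / i + 1 / j) / (i + j)\<close> is at most
  \<open>(1 / i + 1 / j) / m\<close>. Each \<open>j\<close> meets exactly \<open>j\<close> values of
  \<open>i\<close>, hence the terms \<open>1 / j\<close> sum to \<open>m\<close>, and by symmetry so
  do the terms \<open>1 / i\<close>.\<close>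

lemma sum_harmonic_overlap_le:
  assumes "m \<ge> 1"
  shows "(\<Sum>j=1..m. \<Sum>i=Suc (m - j)..m. 1 / (real i * real j)) \<le> 2"
proof -
  have half: "(\<Sum>j=1..m. \<Sum>i=Suc (m - j)..m. 1 / real j) = real m"
  proof -
    have "(\<Sum>i=Suc (m - j)..m. 1 / real j) = 1" if "j \<in> {1..m}" for j using that by simp
    then have "(\<Sum>j=1..m. \<Sum>i=Suc (m - j)..m. 1 / real j) = (\<Sum>j=1..m. 1)"
      by (intro sum.cong refl)
    then show ?thesis by simp
  qed
  have swap: "(\<Sum>j=1..m. \<Sum>i=Suc (m - j)..m. 1 / real i) = (\<Sum>i=1..m. \<Sum>j=Suc (m - i)..m. 1 / real i)"
  proof -
    have dom: "{i \<in> {1..m}. m < j + i} = {Suc (m - j)..m}" "{i \<in> {1..m}. m < i + j} = {Suc (m - j)..m}"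
      if "j \<in> {1..m}" for j
      using that by auto
    have "(\<Sum>j=1..m. \<Sum>i=Suc (m - j)..m. 1 / real i) = (\<Sum>j=1..m. \<Sum>i | i \<in> {1..m} \<and> m < j + i. 1 / real i)"
      using dom by (intro sum.cong refl) (auto simp del: of_nat_Suc)
    also have "\<dots> = (\<Sum>i=1..m. \<Sum>j | j \<in> {1..m} \<and> m < j + i. 1 / real i)"
      by (rule sum.swap_restrict) auto
    also have "\<dots> = (\<Sum>i=1..m. \<Sum>j=Suc (m - i)..m. 1 / real i)"
      using dom by (intro sum.cong refl) auto
    finally show ?thesis .
  qed
  have "(\<Sum>j=1..m. \<Sum>i=Suc (m - j)..m. 1 / (real i * real j))
     \<le> (\<Sum>j=1..m. \<Sum>i=Suc (m - j)..m. (1 / real i + 1 / real j) / real m)"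
  proof (intro sum_mono)
    fix j i assume ji: "j \<in> {1..m}" "i \<in> {Suc (m - j)..m}"
    then have pos: "real i > 0" "real j > 0" "real m > 0" and le: "real m \<le> real i + real j"
      by auto
    have "1 / real i + 1 / real j = (real i + real j) * (1 / (real i * real j))"
      using pos by (simp add: field_simps)
    then have "1 / (real i * real j) = (1 / real i + 1 / real j) / (real i + real j)"
      using pos by simp
    also have "\<dots> \<le> (1 / real i + 1 / real j) / real m"
      using pos le by (intro divide_left_mono) auto
    finally show "1 / (real i * real j) \<le> (1 / real i + 1 / real j) / real m" .
  qed
  also have "\<dots> = ((\<Sum>j=1..m. \<Sum>i=Suc (m - j)..m. 1 / real i) + (\<Sum>j=1..m. \<Sum>i=Suc (m - j)..m. 1 / real j)) / real m"
    by (simp only: sum.distrib[symmetric] sum_divide_distrib)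
  also have "\<dots> = 2" using assms by (simp only: swap half) simp
  finally show ?thesis .
qed

text \<open>This is the cost of replacing \<open>m - j\<close> by \<open>m\<close> in the
  size-biased sum. The unrestricted double sum would have order \<open>ln m ^ 4\<close>, too much
  against a variance of order \<open>ln m ^ 3\<close>; the restriction to \<open>i + j > m\<close>
  brings it down to \<open>ln m ^ 2\<close>.\<close>

lemma sum_ln_overlap_le:
  assumes "m \<ge> 1"
  shows "(\<Sum>j=1..m. ln (real j) / real j * (\<Sum>i=Suc (m - j)..m. ln (real i) / real i)) \<le> 2 * ln (real m) ^ 2"
proof -
  have "(\<Sum>j=1..m. ln (real j) / real j * (\<Sum>i=Suc (m - j)..m. ln (real i) / real i))
    \<le> (\<Sum>j=1..m. \<Sum>i=Suc (m - j)..m. ln (real m) ^ 2 * (1 / (real i * real j)))"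
    unfolding sum_distrib_left
  proof (intro sum_mono)
    fix j i assume ji: "j \<in> {1..m}" "i \<in> {Suc (m - j)..m}"
    then have "ln (real j) * ln (real i) \<le> ln (real m) * ln (real m)"
      by (intro mult_mono) auto
    then have "ln (real j) * ln (real i) * (1 / (real i * real j)) \<le> ln (real m) ^ 2 * (1 / (real i * real j))"
      unfolding power2_eq_square by (rule mult_right_mono) simp
    then show "ln (real j) / real j * (ln (real i) / real i) \<le> ln (real m) ^ 2 * (1 / (real i * real j))"
      by (simp add: mult.commute)
  qed
  also have "\<dots> = ln (real m) ^ 2 * (\<Sum>j=1..m. \<Sum>i=Suc (m - j)..m. 1 / (real i * real j))"
    by (simp only: sum_distrib_left)
  also have "\<dots> \<le> ln (real m) ^ 2 * 2"
    by (intro mult_left_mono sum_harmonic_overlap_le assms) simp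
  finally show ?thesis by simp
qed

section \<open>Variance and Stein discrepancy of the logarithmic cycle product\<close>

text \<open>The size-bias identity for \<open>f w = w - c m\<close> leaves the difference of the
  means for \<open>m - j\<close> and for \<open>m\<close> points, which is not positive and may be
  dropped.\<close>

lemma cexp_variance_le:
  defines "c \<equiv> \<lambda>m. \<Sum>j=1..m. ln (real j) / real j"
  shows "cexp m (\<lambda>w. (w - c m) ^ 2) \<le> (\<Sum>j=1..m. ln (real j) ^ 2 / real j)"
proof -
  have mean: "cexp l (\<lambda>w. w + a) = c l + a" for l a
    by (simp add: cexp_add cexp_mean c_def)
  have mono: "c (m - j) \<le> c m" for j
    unfolding c_def by (intro sum_mono2) auto
  have "cexp m (\<lambda>w. (w - c m) ^ 2) = cexp m (\<lambda>w. w * (w - c m) - c m * (w + - c m))"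
    by (simp add: power2_eq_square algebra_simps)
  also have "\<dots> = cexp m (\<lambda>w. w * (w - c m)) - c m * cexp m (\<lambda>w. w + - c m)"
    by (simp only: cexp_diff cexp_cmult)
  also have "\<dots> = cexp m (\<lambda>w. w * (w - c m))"
    by (simp only: mean) simp
  also have "\<dots> = (\<Sum>j=1..m. ln (real j) / real j * cexp (m - j) (\<lambda>w. w + (ln (real j) - c m)))"
    by (subst cexp_size_bias) (simp add: algebra_simps)
  also have "\<dots> = (\<Sum>j=1..m. ln (real j) / real j * (c (m - j) + (ln (real j) - c m)))"
    by (simp only: mean)
  also have "\<dots> \<le> (\<Sum>j=1..m. ln (real j) / real j * ln (real j))"
    using mono by (intro sum_mono mult_left_mono) auto
  finally show ?thesis by (simp add: power2_eq_square)
qed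

text \<open>In the size-biased sum, passing from \<open>m - j\<close> to \<open>m\<close> points
  costs \<open>T1\<close>, and expanding \<open>f\<close> to first order costs \<open>T2\<close>.
  What remains is \<open>S 1\<close> times the mean of \<open>f\<close> plus
  \<open>S 2 / \<sigma>\<close> times the mean of \<open>f'\<close>; comparison with \<mu> and
  \<sigma> gives the last two terms. The modulus of \<open>f'\<close> may grow with
  \<open>|x|\<close> because the derivative of a Stein solution contains
  \<open>x f(x)\<close>.\<close>

lemma cexp_stein_identity_bound:
  fixes f f' :: "real \<Rightarrow> real" and \<mu> \<sigma> :: real
  assumes m: "m \<ge> 1" and \<sigma>: "\<sigma> > 0"
    and deriv: "\<And>x. (f has_real_derivative f' x) (at x)"
    and c0: "\<And>x. \<bar>f x\<bar> \<le> c0" and c1: "\<And>x. \<bar>f' x\<bar> \<le> c1"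
    and mod: "\<And>x u. u \<ge> 0 \<Longrightarrow> \<bar>f' (x + u) - f' x\<bar> \<le> u * (\<kappa> + c1 * \<bar>x\<bar>)"
  defines "V \<equiv> \<lambda>w. (w - \<mu>) / \<sigma>"
    and "S \<equiv> \<lambda>p. \<Sum>j=1..m. ln (real j) ^ p / real j"
  shows "\<bar>cexp m (\<lambda>w. V w * f (V w)) - cexp m (\<lambda>w. f' (V w))\<bar>
    \<le> 2 * c1 * ln (real m) ^ 2 / \<sigma> ^ 2 + S 3 / \<sigma> ^ 3 * (\<kappa> + c1 * cexp m (\<lambda>w. \<bar>V w\<bar>))
      + \<bar>S 1 - \<mu>\<bar> / \<sigma> * c0 + \<bar>S 2 / \<sigma> ^ 2 - 1\<bar> * c1"
proof -
  let ?a = "\<lambda>j. ln (real j)"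
  define F where "F = (\<lambda>w. f (V w))"
  define EF where "EF = cexp m F"
  define EF' where "EF' = cexp m (\<lambda>w. f' (V w))"
  define EV where "EV = cexp m (\<lambda>w. \<bar>V w\<bar>)"
  have V_add: "V (w + a) = V w + a / \<sigma>" for w a
    by (simp add: V_def add_divide_distrib diff_divide_distrib)
  have c1_nonneg: "c1 \<ge> 0" using c1[of 0] by linarith
  have f_lip: "\<bar>f x - f y\<bar> \<le> c1 * \<bar>x - y\<bar>" for x y
    using field_differentiable_bound[of UNIV f f' c1 x y] deriv c1 by (auto simp: norm_minus_commute)
  have F_lip: "\<bar>F (u + a) - F (v + a)\<bar> \<le> c1 / \<sigma> * \<bar>u - v\<bar>" for u v a
  proof -
    have "V (u + a) - V (v + a) = (u - v) / \<sigma>" by (simp add: V_def diff_divide_distrib add_divide_distrib)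
    then show ?thesis using f_lip[of "V (u + a)" "V (v + a)"] \<sigma> by (simp add: F_def abs_divide)
  qed
  \<comment> \<open>The mean value theorem together with \<open>mod\<close> replaces a second
    derivative: for a test function with corners, \<open>f'\<close> is locally Lipschitz but need
    not be differentiable.\<close>
  have taylor: "\<bar>F (w + a) - F w - a / \<sigma> * f' (V w)\<bar> \<le> (a / \<sigma>) ^ 2 * (\<kappa> + c1 * \<bar>V w\<bar>)"
    if "a \<ge> 0" for w a
  proof (cases "a = 0")
    case False
    then have pos: "a / \<sigma> > 0" using that \<sigma> by simp
    obtain z where z: "V w < z" "z < V w + a / \<sigma>" "f (V w + a / \<sigma>) - f (V w) = (V w + a / \<sigma> - V w) * f' z"
      using MVT2[of "V w" "V w + a / \<sigma>" f f'] pos deriv by auto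
    have "0 \<le> z - V w" using z by simp
    from mod[OF this, of "V w"] have "\<bar>f' z - f' (V w)\<bar> \<le> (z - V w) * (\<kappa> + c1 * \<bar>V w\<bar>)" by simp
    also have "\<dots> \<le> (a / \<sigma>) * (\<kappa> + c1 * \<bar>V w\<bar>)"
    proof (rule mult_right_mono)
      have "0 \<le> 1 * (\<kappa> + c1 * \<bar>V w\<bar>)" using mod[of 1 "V w"] by linarith
      then show "0 \<le> \<kappa> + c1 * \<bar>V w\<bar>" by simp
    qed (use z in simp)
    finally have "(a / \<sigma>) * \<bar>f' z - f' (V w)\<bar> \<le> (a / \<sigma>) * ((a / \<sigma>) * (\<kappa> + c1 * \<bar>V w\<bar>))"
      using pos by (intro mult_left_mono) auto
    moreover have "F (w + a) - F w - a / \<sigma> * f' (V w) = (a / \<sigma>) * (f' z - f' (V w))"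
      using z(3) unfolding F_def V_add[of w a] by (simp add: algebra_simps)
    ultimately show ?thesis
      using pos by (simp only: abs_mult abs_of_pos power2_eq_square mult.assoc)
  qed simp
  define T1 where "T1 = (\<Sum>j=1..m. ?a j / real j * (cexp (m - j) (\<lambda>w. F (w + ?a j)) - cexp m (\<lambda>w. F (w + ?a j))))"
  define T2 where "T2 = (\<Sum>j=1..m. ?a j / real j * (cexp m (\<lambda>w. F (w + ?a j)) - EF - ?a j / \<sigma> * EF'))"
  have "\<bar>T1\<bar> \<le> (\<Sum>j=1..m. ?a j / real j * (c1 / \<sigma> * (\<Sum>i=Suc (m - j)..m. ?a i / real i)))"
    unfolding T1_def
  proof (rule order_trans[OF sum_abs], intro sum_mono)
    fix j assume j: "j \<in> {1..m}"
    have "\<bar>cexp (m - j) (\<lambda>w. F (w + ?a j)) - cexp m (\<lambda>w. F (w + ?a j))\<bar>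
      \<le> c1 / \<sigma> * (\<Sum>i=Suc (m - j)..m. ?a i / real i)"
      by (rule cexp_Lipschitz_diff[OF F_lip]) simp
    then show "\<bar>?a j / real j * (cexp (m - j) (\<lambda>w. F (w + ?a j)) - cexp m (\<lambda>w. F (w + ?a j)))\<bar>
      \<le> ?a j / real j * (c1 / \<sigma> * (\<Sum>i=Suc (m - j)..m. ?a i / real i))"
      using j unfolding abs_mult by (intro mult_mono) auto
  qed
  also have "\<dots> = c1 / \<sigma> * (\<Sum>j=1..m. ?a j / real j * (\<Sum>i=Suc (m - j)..m. ?a i / real i))"
    by (subst sum_distrib_left) (intro sum.cong refl mult.left_commute)
  also have "\<dots> \<le> c1 / \<sigma> * (2 * ln (real m) ^ 2)"
    using c1_nonneg \<sigma> by (intro mult_left_mono sum_ln_overlap_le m) auto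
  finally have T1: "\<bar>T1\<bar> / \<sigma> \<le> 2 * c1 * ln (real m) ^ 2 / \<sigma> ^ 2"
    using \<sigma> by (simp add: power2_eq_square field_simps)
  have "\<bar>T2\<bar> \<le> (\<Sum>j=1..m. ?a j / real j * ((?a j / \<sigma>) ^ 2 * (\<kappa> + c1 * EV)))"
    unfolding T2_def
  proof (rule order_trans[OF sum_abs], intro sum_mono)
    fix j assume j: "j \<in> {1..m}"
    have "cexp m (\<lambda>w. F (w + ?a j)) - EF - ?a j / \<sigma> * EF'
      = cexp m (\<lambda>w. F (w + ?a j) - F w - ?a j / \<sigma> * f' (V w))"
      by (simp only: cexp_diff cexp_cmult EF_def EF'_def)
    also have "\<bar>\<dots>\<bar> \<le> cexp m (\<lambda>w. (?a j / \<sigma>) ^ 2 * (\<kappa> + c1 * \<bar>V w\<bar>))"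
      using j by (intro cexp_abs_le taylor) auto
    also have "\<dots> = (?a j / \<sigma>) ^ 2 * (\<kappa> + c1 * EV)"
      by (simp only: cexp_cmult cexp_add cexp_const EV_def)
    finally show "\<bar>?a j / real j * (cexp m (\<lambda>w. F (w + ?a j)) - EF - ?a j / \<sigma> * EF')\<bar>
      \<le> ?a j / real j * ((?a j / \<sigma>) ^ 2 * (\<kappa> + c1 * EV))"
      using j unfolding abs_mult by (intro mult_mono) auto
  qed
  also have "\<dots> = S 3 / \<sigma> ^ 2 * (\<kappa> + c1 * EV)"
    unfolding S_def sum_divide_distrib sum_distrib_right
    by (intro sum.cong refl) (simp add: power_divide power2_eq_square power3_eq_cube)
  finally have T2: "\<bar>T2\<bar> / \<sigma> \<le> S 3 / \<sigma> ^ 3 * (\<kappa> + c1 * EV)"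
    using \<sigma> by (simp add: power2_eq_square power3_eq_cube field_simps)
  have "cexp m (\<lambda>w. w * F w) = T1 + T2 + S 1 * EF + S 2 / \<sigma> * EF'"
    unfolding cexp_size_bias T1_def T2_def S_def sum_divide_distrib sum_distrib_right sum.distrib[symmetric]
    by (intro sum.cong refl) (simp add: power2_eq_square algebra_simps)
  moreover have "cexp m (\<lambda>w. V w * f (V w)) = (cexp m (\<lambda>w. w * F w) - \<mu> * EF) / \<sigma>"
  proof -
    have "cexp m (\<lambda>w. V w * f (V w)) = cexp m (\<lambda>w. 1 / \<sigma> * (w * F w) + - (\<mu> / \<sigma>) * F w)"
      by (rule arg_cong[where f = "cexp m"]) (auto simp: V_def F_def field_simps diff_divide_distrib)
    also have "\<dots> = 1 / \<sigma> * cexp m (\<lambda>w. w * F w) + - (\<mu> / \<sigma>) * EF"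
      unfolding cexp_linear EF_def ..
    finally show ?thesis by (simp add: diff_divide_distrib)
  qed
  ultimately have "cexp m (\<lambda>w. V w * f (V w)) - EF'
      = (T1 + T2 + S 1 * EF + S 2 / \<sigma> * EF' - \<mu> * EF) / \<sigma> - EF'"
    by simp
  also have "\<dots> = T1 / \<sigma> + T2 / \<sigma> + (S 1 - \<mu>) / \<sigma> * EF + (S 2 / \<sigma> ^ 2 - 1) * EF'"
    using \<sigma> by (simp add: field_simps power2_eq_square)
  also have "\<bar>\<dots>\<bar> \<le> \<bar>T1\<bar> / \<sigma> + \<bar>T2\<bar> / \<sigma> + \<bar>S 1 - \<mu>\<bar> / \<sigma> * \<bar>EF\<bar> + \<bar>S 2 / \<sigma> ^ 2 - 1\<bar> * \<bar>EF'\<bar>"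
    using \<sigma> by (intro order_trans[OF abs_triangle_ineq] add_mono) (auto simp: abs_mult abs_divide)
  also have "\<dots> \<le> \<bar>T1\<bar> / \<sigma> + \<bar>T2\<bar> / \<sigma> + \<bar>S 1 - \<mu>\<bar> / \<sigma> * c0 + \<bar>S 2 / \<sigma> ^ 2 - 1\<bar> * c1"
  proof -
    have "\<bar>EF\<bar> \<le> c0" unfolding EF_def F_def using cexp_abs_le[of "\<lambda>w. f (V w)" "\<lambda>_. c0" m] c0 by simp
    moreover have "\<bar>EF'\<bar> \<le> c1" unfolding EF'_def using cexp_abs_le[of "\<lambda>w. f' (V w)" "\<lambda>_. c1" m] c1 by simp
    ultimately show ?thesis using \<sigma> by (intro add_mono mult_left_mono order_refl) auto
  qed
  finally show ?thesis using T1 T2 unfolding EF'_def EV_def by linarith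
qed

text \<open>In the application \<open>t\<close> is the square root of \<open>ell\<close>, so that
  centre and scale are monomials in \<open>t\<close>. An offset \<open>D\<close> of
  \<open>ln m\<close> from \<open>t^2\<close> shifts the mean by \<open>O(t^2 (1 + D))\<close>, that
  is \<open>O((1 + D) / t)\<close> on the scale \<open>t^3\<close>, and changes the variance by a
  relative \<open>O((1 + D) / t^2)\<close>, weakened to the same order. The bounds 6 and 2 are those
  of the Stein solution constructed below.\<close>

lemma cexp_stein_bound:
  fixes f f' :: "real \<Rightarrow> real"
  assumes m: "m \<ge> 1" and t: "t \<ge> 1" and Lt: "ln (real m) \<le> 2 * t ^ 2" and \<kappa>: "\<kappa> \<ge> 0"
    and deriv: "\<And>x. (f has_real_derivative f' x) (at x)"
    and c0: "\<And>x. \<bar>f x\<bar> \<le> 6" and c1: "\<And>x. \<bar>f' x\<bar> \<le> 2"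
    and mod: "\<And>x u. u \<ge> 0 \<Longrightarrow> \<bar>f' (x + u) - f' x\<bar> \<le> u * (\<kappa> + 2 * \<bar>x\<bar>)"
  defines "V \<equiv> \<lambda>w. (w - t ^ 4 / 2) / (t ^ 3 / sqrt 3)" and "D \<equiv> \<bar>ln (real m) - t ^ 2\<bar>"
  shows "\<bar>cexp m (\<lambda>w. V w * f (V w)) - cexp m (\<lambda>w. f' (V w))\<bar> \<le> 5856 * (1 + D) * (1 + \<kappa>) / t"
proof -
  define L \<mu> \<sigma> S where "L = ln (real m)" and "\<mu> = t ^ 4 / 2" and "\<sigma> = t ^ 3 / sqrt 3"
    and "S = (\<lambda>p. \<Sum>j=1..m. ln (real j) ^ p / real j)"
  have V_def': "V = (\<lambda>w. (w - \<mu>) / \<sigma>)" by (simp add: V_def \<mu>_def \<sigma>_def)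
  have L: "0 \<le> L" "L \<le> 2 * t ^ 2" using m Lt by (auto simp: L_def)
  have D: "D = \<bar>L - t ^ 2\<bar>" "D \<ge> 0" by (auto simp: D_def L_def)
  have \<sigma>: "\<sigma> > 0" using t by (simp add: \<sigma>_def)
  have \<sigma>2: "\<sigma> ^ 2 = t ^ 6 / 3" using t by (simp add: \<sigma>_def power_divide flip: power_mult)
  have \<sigma>1: "1 / \<sigma> \<le> 2 / t ^ 3"
  proof -
    have "sqrt 3 \<le> sqrt 4" by (rule real_sqrt_le_mono) simp
    then show ?thesis using t by (simp add: \<sigma>_def divide_right_mono)
  qed
  have t2: "1 \<le> t ^ 2" using t by simp
  have S1: "\<bar>S 1 - L ^ 2 / 2\<bar> \<le> L" and S2: "\<bar>S 2 - L ^ 3 / 3\<bar> \<le> L ^ 2" and S3: "S 3 \<le> L ^ 4 / 4 + L ^ 3"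
    using sum_ln_power_div_upper[OF m, of 0] sum_ln_power_div_lower[OF m, of 0]
      sum_ln_power_div_upper[OF m, of 1] sum_ln_power_div_lower[OF m, of 1]
      sum_ln_power_div_upper[OF m, of 2]
    by (simp_all add: S_def L_def eval_nat_numeral abs_le_iff)
  have "\<bar>S 1 - \<mu>\<bar> \<le> L + \<bar>L ^ 2 - (t ^ 2) ^ 2\<bar> / 2"
  proof -
    have "S 1 - \<mu> = (S 1 - L ^ 2 / 2) + (L ^ 2 - (t ^ 2) ^ 2) / 2"
      by (simp add: \<mu>_def field_simps flip: power_mult)
    then show ?thesis
      using S1 abs_triangle_ineq[of "S 1 - L ^ 2 / 2" "(L ^ 2 - (t ^ 2) ^ 2) / 2"] by (simp add: abs_divide)
  qed
  also have "\<bar>L ^ 2 - (t ^ 2) ^ 2\<bar> = D * (L + t ^ 2)"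
    using L t by (simp add: D(1) power2_eq_square square_diff_square_factored abs_mult mult.commute)
  also have "L + D * (L + t ^ 2) / 2 \<le> 2 * t ^ 2 + D * (2 * t ^ 2 + t ^ 2) / 2"
    using L D by (intro add_mono divide_right_mono mult_left_mono) auto
  also have "\<dots> \<le> 2 * t ^ 2 * (1 + D)" using D by (simp add: algebra_simps)
  finally have mu: "\<bar>S 1 - \<mu>\<bar> \<le> 2 * t ^ 2 * (1 + D)" by (simp add: D)
  have "\<bar>S 1 - \<mu>\<bar> / \<sigma> = \<bar>S 1 - \<mu>\<bar> * (1 / \<sigma>)" by simp
  also have "\<dots> \<le> (2 * t ^ 2 * (1 + D)) * (2 / t ^ 3)"
    using mu \<sigma>1 \<sigma> D(2) by (intro mult_mono) auto
  also have "\<dots> = 4 * (1 + D) / t" using t by (simp add: power2_eq_square power3_eq_cube)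
  finally have mu\<sigma>: "\<bar>S 1 - \<mu>\<bar> / \<sigma> \<le> 4 * (1 + D) / t" .
  have "\<bar>S 2 - t ^ 6 / 3\<bar> \<le> L ^ 2 + \<bar>L ^ 3 - (t ^ 2) ^ 3\<bar> / 3"
  proof -
    have "S 2 - t ^ 6 / 3 = (S 2 - L ^ 3 / 3) + (L ^ 3 - (t ^ 2) ^ 3) / 3"
      by (simp add: field_simps flip: power_mult)
    then show ?thesis
      using S2 abs_triangle_ineq[of "S 2 - L ^ 3 / 3" "(L ^ 3 - (t ^ 2) ^ 3) / 3"] by (simp add: abs_divide)
  qed
  also have "\<bar>L ^ 3 - (t ^ 2) ^ 3\<bar> = D * (L ^ 2 + L * t ^ 2 + (t ^ 2) ^ 2)"
  proof -
    have "L ^ 3 - (t ^ 2) ^ 3 = (L - t ^ 2) * (L ^ 2 + L * t ^ 2 + (t ^ 2) ^ 2)"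
      by (simp add: power2_eq_square power3_eq_cube algebra_simps)
    then show ?thesis using L by (simp add: abs_mult D(1))
  qed
  also have "L ^ 2 + D * (L ^ 2 + L * t ^ 2 + (t ^ 2) ^ 2) / 3
      \<le> (2 * t ^ 2) ^ 2 + D * ((2 * t ^ 2) ^ 2 + (2 * t ^ 2) * t ^ 2 + (t ^ 2) ^ 2) / 3"
    using L D t by (intro add_mono divide_right_mono mult_left_mono mult_right_mono power_mono) auto
  also have "\<dots> \<le> 4 * t ^ 4 * (1 + D)"
    using D t by (simp add: algebra_simps flip: power_mult power_add)
  finally have "\<bar>S 2 - t ^ 6 / 3\<bar> \<le> 4 * t ^ 4 * (1 + D)" by (simp add: D)
  moreover have "\<bar>S 2 / \<sigma> ^ 2 - 1\<bar> = \<bar>S 2 - t ^ 6 / 3\<bar> * (3 / t ^ 6)"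
  proof -
    have "S 2 / \<sigma> ^ 2 - 1 = (S 2 - t ^ 6 / 3) * (3 / t ^ 6)" using t by (simp add: \<sigma>2 field_simps)
    moreover have "\<bar>3 / t ^ 6\<bar> = 3 / t ^ 6" using t by simp
    ultimately show ?thesis by (simp only: abs_mult)
  qed
  ultimately have "\<bar>S 2 / \<sigma> ^ 2 - 1\<bar> \<le> 4 * t ^ 4 * (1 + D) * (3 / t ^ 6)"
    using t by (simp only:) (intro mult_right_mono, auto)
  also have "\<dots> = 12 * (1 + D) / t * (1 / t)" using t by (simp add: field_simps eval_nat_numeral)
  also have "\<dots> \<le> 12 * (1 + D) / t * 1" using t D by (intro mult_left_mono) auto
  finally have var: "\<bar>S 2 / \<sigma> ^ 2 - 1\<bar> \<le> 12 * (1 + D) / t" by simp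
  have inv: "c * (1 + D) / t \<le> c * (1 + D)" if "c \<ge> 0" for c
    using mult_left_mono[OF t, of "c * (1 + D)"] that t D(2) by (simp add: divide_le_eq)
  \<comment> \<open>The variance bound is about the true mean \<open>S 1\<close>, so
    \<open>V\<close> is recentred there; \<open>|x| <= x^2 / 2 + 1 / 2\<close> then avoids a square
    root.\<close>
  have EV: "cexp m (\<lambda>w. \<bar>V w\<bar>) \<le> 11 * (1 + D)"
  proof -
    have pointwise: "\<bar>V w\<bar> \<le> 1 / (2 * \<sigma> ^ 2) * (w - S 1) ^ 2 + 1 * (1 / 2 + \<bar>S 1 - \<mu>\<bar> / \<sigma>)" for w
    proof -
      define x B where "x = (w - S 1) / \<sigma>" and "B = \<bar>S 1 - \<mu>\<bar> / \<sigma>"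
      have "V w = x + (S 1 - \<mu>) / \<sigma>" by (simp add: V_def' x_def diff_divide_distrib)
      then have "\<bar>V w\<bar> \<le> \<bar>x\<bar> + B"
        using \<sigma> abs_triangle_ineq[of x "(S 1 - \<mu>) / \<sigma>"] by (simp add: B_def abs_divide)
      moreover have "\<bar>x\<bar> \<le> x ^ 2 / 2 + 1 / 2"
        using zero_le_power2[of "\<bar>x\<bar> - 1"] by (simp add: power2_diff)
      moreover have "1 / (2 * \<sigma> ^ 2) * (w - S 1) ^ 2 = x ^ 2 / 2" by (simp add: x_def power_divide)
      moreover have "p \<le> u + 1 * (1 / 2 + b)" if "p \<le> q + b" "q \<le> v + 1 / 2" "u = v" for p q u v b :: real
        using that by simp
      ultimately show ?thesis unfolding B_def[symmetric] by blast
    qed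
    have "cexp m (\<lambda>w. \<bar>V w\<bar>) \<le> cexp m (\<lambda>w. 1 / (2 * \<sigma> ^ 2) * (w - S 1) ^ 2 + 1 * (1 / 2 + \<bar>S 1 - \<mu>\<bar> / \<sigma>))"
      by (rule cexp_mono[OF pointwise])
    also have "\<dots> = 1 / (2 * \<sigma> ^ 2) * cexp m (\<lambda>w. (w - S 1) ^ 2) + 1 * (1 / 2 + \<bar>S 1 - \<mu>\<bar> / \<sigma>)"
      by (simp only: cexp_linear cexp_const)
    also have "\<dots> \<le> 1 / (2 * \<sigma> ^ 2) * S 2 + 1 * (1 / 2 + \<bar>S 1 - \<mu>\<bar> / \<sigma>)"
      using cexp_variance_le[of m] by (intro add_right_mono mult_left_mono) (auto simp: S_def)
    also have "\<dots> = (S 2 / \<sigma> ^ 2) / 2 + (1 / 2 + \<bar>S 1 - \<mu>\<bar> / \<sigma>)" by simp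
    finally have "cexp m (\<lambda>w. \<bar>V w\<bar>) \<le> (S 2 / \<sigma> ^ 2) / 2 + (1 / 2 + \<bar>S 1 - \<mu>\<bar> / \<sigma>)" .
    moreover have "S 2 / \<sigma> ^ 2 \<le> 1 + 12 * (1 + D)" using order_trans[OF var inv[of 12]] by simp
    moreover have "\<bar>S 1 - \<mu>\<bar> / \<sigma> \<le> 4 * (1 + D)" using order_trans[OF mu\<sigma> inv[of 4]] by simp
    ultimately show ?thesis using D(2) by simp
  qed
  have S3\<sigma>: "S 3 / \<sigma> ^ 3 \<le> 96 / t"
  proof -
    have "S 3 \<le> L ^ 4 / 4 + L ^ 3" by (rule S3)
    also have "\<dots> \<le> (2 * t ^ 2) ^ 4 / 4 + (2 * t ^ 2) ^ 3"
      using L by (intro add_mono divide_right_mono power_mono) auto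
    also have "\<dots> = 4 * t ^ 8 + 8 * t ^ 6 * 1" by (simp add: power_mult_distrib flip: power_mult)
    also have "\<dots> \<le> 4 * t ^ 8 + 8 * t ^ 6 * t ^ 2"
      using t t2 by (intro add_mono mult_left_mono) auto
    also have "\<dots> = 12 * t ^ 8" by (simp flip: power_add)
    finally have S3': "S 3 \<le> 12 * t ^ 8" .
    have "(1 / \<sigma>) ^ 3 \<le> (2 / t ^ 3) ^ 3" using \<sigma>1 \<sigma> by (intro power_mono) auto
    then have "S 3 * (1 / \<sigma>) ^ 3 \<le> (12 * t ^ 8) * (2 / t ^ 3) ^ 3"
      using S3' \<sigma> t by (intro mult_mono) auto
    also have "\<dots> = 96 / t" using t by (simp add: field_simps eval_nat_numeral)
    finally show ?thesis by (simp add: power_divide)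
  qed
  have first: "2 * 2 * L ^ 2 / \<sigma> ^ 2 \<le> 48 / t"
  proof -
    have "2 * 2 * L ^ 2 / \<sigma> ^ 2 \<le> 2 * 2 * (2 * t ^ 2) ^ 2 / \<sigma> ^ 2"
      using L by (intro divide_right_mono mult_left_mono power_mono) auto
    also have "\<dots> = 48 / t * (1 / t)" unfolding \<sigma>2 using t by (simp add: field_simps eval_nat_numeral)
    also have "\<dots> \<le> 48 / t * 1" using t by (intro mult_left_mono) auto
    finally show ?thesis by simp
  qed
  have third: "S 3 / \<sigma> ^ 3 * (\<kappa> + 2 * cexp m (\<lambda>w. \<bar>V w\<bar>)) \<le> 96 / t * (\<kappa> + 2 * (11 * (1 + D)))"
  proof (rule mult_mono)
    have "0 \<le> cexp m (\<lambda>w. \<bar>V w\<bar>)" using cexp_mono[of "\<lambda>_. 0" "\<lambda>w. \<bar>V w\<bar>" m] by simp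
    then show "0 \<le> \<kappa> + 2 * cexp m (\<lambda>w. \<bar>V w\<bar>)" using \<kappa> by simp
  qed (use S3\<sigma> EV t in auto)
  have "\<bar>cexp m (\<lambda>w. V w * f (V w)) - cexp m (\<lambda>w. f' (V w))\<bar>
    \<le> 2 * 2 * L ^ 2 / \<sigma> ^ 2 + S 3 / \<sigma> ^ 3 * (\<kappa> + 2 * cexp m (\<lambda>w. \<bar>V w\<bar>))
      + \<bar>S 1 - \<mu>\<bar> / \<sigma> * 6 + \<bar>S 2 / \<sigma> ^ 2 - 1\<bar> * 2"
    unfolding V_def' L_def S_def
    by (rule cexp_stein_identity_bound[OF m \<sigma> deriv c0 c1 mod])
  also have "\<dots> \<le> 48 / t + 96 / t * (\<kappa> + 2 * (11 * (1 + D))) + 4 * (1 + D) / t * 6 + 12 * (1 + D) / t * 2"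
    using first third mu\<sigma> var by (intro add_mono mult_right_mono) auto
  also have "\<dots> = (48 + 96 * (\<kappa> + 2 * (11 * (1 + D))) + 24 * (1 + D) + 24 * (1 + D)) / t"
    by (simp add: add_divide_distrib)
  \<comment> \<open>The coefficients add up to at most
    \<open>2208 * (1 + D) * (1 + \<kappa>)\<close>; the stated constant leaves room.\<close>
  also have "\<dots> \<le> 5856 * (1 + D) * (1 + \<kappa>) / t"
    using t D \<kappa> by (intro divide_right_mono) (auto simp: algebra_simps)
  finally show ?thesis .
qed

section \<open>Cyclic points of a mapping\<close>

text \<open>The set \<open>orbit f x\<close> begins with \<open>f x\<close>, so \<open>x\<close>
  belongs to it exactly when some positive iterate returns to \<open>x\<close>.\<close>

definition core :: "nat \<Rightarrow> (nat \<Rightarrow> nat) \<Rightarrow> nat set" where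
  "core n f = {x \<in> {1..n}. x \<in> orbit f x}"

lemma finite_core [simp]: "finite (core n f)"
  by (simp add: core_def)

lemma core_subset: "core n f \<subseteq> {1..n}"
  by (auto simp: core_def)

lemma finite_zero_k_mappings [simp]: "finite (zero_k_mappings k n)"
  unfolding zero_k_mappings_def by (rule finite_subset[of _ "{1..n} \<rightarrow>\<^sub>E {1..n}"]) (auto intro: finite_PiE)

lemma zero_k_mappings_in: "f \<in> zero_k_mappings k n \<Longrightarrow> x \<in> {1..n} \<Longrightarrow> f x \<in> {1..n}"
  unfolding zero_k_mappings_def by blast

lemma zero_k_mappings_funpow_in:
  "f \<in> zero_k_mappings k n \<Longrightarrow> x \<in> {1..n} \<Longrightarrow> (f ^^ i) x \<in> {1..n}"
proof (induction i)
  case (Suc i)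
  then show ?case using zero_k_mappings_in[of f k n "(f ^^ i) x"] by simp
qed simp

text \<open>Precomposition only relabels the fibres, so their sizes survive. Both the rearrangements
  of the core and the exchanges of two values used for switching have this form.\<close>

lemma zero_k_mappings_compose:
  assumes f: "f \<in> zero_k_mappings k n" and p: "p permutes {1..n}"
  shows "f \<circ> p \<in> zero_k_mappings k n"
proof -
  have card_eq: "card {x \<in> {1..n}. (f \<circ> p) x = y} = card {x \<in> {1..n}. f x = y}" for y
  proof -
    have "{x \<in> {1..n}. f x = y} = p ` {x \<in> {1..n}. (f \<circ> p) x = y}"
    proof (intro equalityI subsetI)
      fix z assume z: "z \<in> {x \<in> {1..n}. f x = y}"
      then obtain x where "x \<in> {1..n}" "z = p x" using permutes_image[OF p] by blast
      then show "z \<in> p ` {x \<in> {1..n}. (f \<circ> p) x = y}" using z by auto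
    next
      fix z assume "z \<in> p ` {x \<in> {1..n}. (f \<circ> p) x = y}"
      then obtain x where "x \<in> {1..n}" "z = p x" "f (p x) = y" by auto
      then show "z \<in> {x \<in> {1..n}. f x = y}" using permutes_in_image[OF p, of x] by simp
    qed
    then show ?thesis by (simp only: card_image[OF inj_on_subset[OF permutes_inj[OF p] subset_UNIV]])
  qed
  have "f \<circ> p \<in> {1..n} \<rightarrow>\<^sub>E {1..n}"
  proof (intro PiE_I)
    fix x assume "x \<in> {1..n}"
    then show "(f \<circ> p) x \<in> {1..n}"
      using zero_k_mappings_in[OF f, of "p x"] permutes_in_image[OF p, of x] by simp
  next
    fix x assume "x \<notin> {1..n}"
    then show "(f \<circ> p) x = undefined"
      using f permutes_not_in[OF p, of x] by (auto simp: zero_k_mappings_def)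
  qed
  moreover have "\<forall>y\<in>{1..n}. card {x \<in> {1..n}. (f \<circ> p) x = y} \<in> {0, k}"
    using f unfolding card_eq zero_k_mappings_def by blast
  ultimately show ?thesis unfolding zero_k_mappings_def by blast
qed

section \<open>The permutation induced on the cyclic points\<close>

lemma inj_on_cyclic:
  assumes "cyclic_on f C"
  shows "inj_on f C"
proof (rule finite_surj_inj[OF finite_cyclic_on[OF assms]])
  obtain s where s: "s \<in> C" "C = orbit f s" using assms by (auto simp: cyclic_on_def)
  show "C \<subseteq> f ` C"
  proof
    fix x assume "x \<in> C"
    then have "x \<in> orbit f s" using s(2) by simp
    then show "x \<in> f ` C"
      by cases (use s in auto)
  qed
qed

lemma cyclic_on_orbit_self: "x \<in> orbit f x \<Longrightarrow> cyclic_on f (orbit f x)"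
  by (auto simp: cyclic_on_def)

lemma core_closed:
  assumes "f \<in> zero_k_mappings k n" "x \<in> core n f"
  shows "f x \<in> core n f" "orbit f x \<subseteq> core n f"
proof -
  have 1: "f x \<in> core n f" if "x \<in> core n f" for x
    using that zero_k_mappings_in[OF assms(1), of x] self_in_orbit_step[of x f] orbit.base[of f x]
    by (auto simp: core_def)
  show "orbit f x \<subseteq> core n f"
  proof
    fix y assume "y \<in> orbit f x"
    then show "y \<in> core n f" by (induction rule: orbit.induct) (use assms(2) 1 in auto)
  qed
  show "f x \<in> core n f" by (rule 1[OF assms(2)])
qed

lemma bij_betw_core:
  assumes "f \<in> zero_k_mappings k n"
  shows "bij_betw f (core n f) (core n f)"
proof -
  have "inj_on f (core n f)"
  proof (rule inj_onI)
    fix x y assume xy: "x \<in> core n f" "y \<in> core n f" "f x = f y"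
    have self: "x \<in> orbit f x" "y \<in> orbit f y" using xy by (auto simp: core_def)
    then have "orbit f x = orbit f y" using self_in_orbit_step xy(3) by metis
    then show "x = y"
      using inj_on_cyclic[OF cyclic_on_orbit_self[OF self(1)]] self xy(3) by (auto dest: inj_onD)
  qed
  moreover have "f ` core n f \<subseteq> core n f" using core_closed(1)[OF assms] by auto
  ultimately show ?thesis
    using endo_inj_surj[OF finite_core] by (auto simp: bij_betw_def)
qed

lemma perm_restrict_core:
  assumes "f \<in> zero_k_mappings k n"
  shows "perm_restrict f (core n f) permutes core n f"
proof (rule bij_imp_permutes)
  show "bij_betw (perm_restrict f (core n f)) (core n f) (core n f)"
    using bij_betw_core[OF assms] bij_betw_cong[of "core n f" "perm_restrict f (core n f)" f]
    by (auto simp: perm_restrict_def)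
qed (simp add: perm_restrict_def)

lemma cycles_of_mapping_core:
  "cycles_of_mapping n f = perm_cycles (core n f) (perm_restrict f (core n f))"
proof -
  have sub: "C \<subseteq> core n f" if "C \<subseteq> {1..n}" "cyclic_on f C" for C
    using that orbit_cyclic_eq3[OF that(2)] by (auto simp: core_def)
  have iff: "cyclic_on (perm_restrict f (core n f)) C \<longleftrightarrow> cyclic_on f C" if "C \<subseteq> core n f" for C
    using that by (intro cyclic_cong) (auto simp: perm_restrict_def)
  show ?thesis
    unfolding cycles_of_mapping_def perm_cycles_def
  proof (intro Collect_cong iffI conjI; elim conjE)
    fix C assume C: "C \<subseteq> {1..n}" "cyclic_on f C"
    show "C \<subseteq> core n f" by (rule sub[OF C])
    then show "cyclic_on (perm_restrict f (core n f)) C" using C(2) iff by simp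
  next
    fix C assume C: "C \<subseteq> core n f" "cyclic_on (perm_restrict f (core n f)) C"
    show "C \<subseteq> {1..n}" by (rule order_trans[OF C(1) core_subset])
    show "cyclic_on f C" using C iff by simp
  qed
qed

text \<open>A cycle of \<open>f \<circ> p\<close> through a point outside the core never meets the
  core, which \<open>f \<circ> p\<close> maps into itself. Off the core \<open>p\<close> is the
  identity, so this would be a cycle of \<open>f\<close> outside its own core. On the core, both
  factors act as permutations.\<close>

lemma core_compose:
  assumes f: "f \<in> zero_k_mappings k n" and p: "p permutes core n f"
  shows "core n (f \<circ> p) = core n f"
    and "perm_restrict (f \<circ> p) (core n f) = perm_restrict f (core n f) \<circ> p"
proof -
  let ?A = "core n f"
  show restr: "perm_restrict (f \<circ> p) ?A = perm_restrict f ?A \<circ> p"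
  proof
    fix x show "perm_restrict (f \<circ> p) ?A x = (perm_restrict f ?A \<circ> p) x"
      using permutes_in_image[OF p, of x] permutes_not_in[OF p, of x] by (auto simp: perm_restrict_def)
  qed
  have perm: "perm_restrict (f \<circ> p) ?A permutes ?A"
    unfolding restr by (rule permutes_compose[OF p perm_restrict_core[OF f]])
  have closed: "(f \<circ> p) x \<in> ?A" if "x \<in> ?A" for x
    using that core_closed(1)[OF f, of "p x"] permutes_in_image[OF p, of x] by simp
  have orbit_closed: "y \<in> ?A" if "y \<in> orbit (f \<circ> p) x" "x \<in> ?A" for x y
    using that by (induction rule: orbit.induct) (auto simp del: o_apply intro: closed)
  show "core n (f \<circ> p) = ?A"
  proof (intro equalityI subsetI)
    fix x assume x: "x \<in> core n (f \<circ> p)"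
    then have self: "x \<in> orbit (f \<circ> p) x" by (simp add: core_def)
    show "x \<in> ?A"
    proof (rule ccontr)
      assume notin: "x \<notin> ?A"
      have "y \<notin> ?A" if "y \<in> orbit (f \<circ> p) x" for y
        using orbit_swap[OF self that] orbit_closed notin by blast
      then have "orbit f x = orbit (f \<circ> p) x"
        using permutes_not_in[OF p] by (intro orbit_cong self) simp
      then show False using self x notin by (simp add: core_def)
    qed
  next
    fix x assume x: "x \<in> ?A"
    have self: "x \<in> orbit (perm_restrict (f \<circ> p) ?A) x"
      using perm permutation_self_in_orbit permutation_permutes finite_core by metis
    have "orbit (f \<circ> p) x = orbit (perm_restrict (f \<circ> p) ?A) x"
      using permutes_orbit_subset[OF perm x]
      by (intro orbit_cong self) (auto simp: perm_restrict_def)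
    then show "x \<in> core n (f \<circ> p)" using self x by (simp add: core_def)
  qed
qed

text \<open>The mappings with core \<open>A\<close> are permuted freely by right composition with permutations of \<open>A\<close>;
  hence, given its core, a mapping acts on it as a uniform permutation.\<close>

lemma sum_core_symmetrize:
  fixes H :: "nat set set \<Rightarrow> real" and k n :: nat
  defines "M \<equiv> zero_k_mappings k n"
  shows "fact (card A) * (\<Sum>f | f \<in> M \<and> core n f = A. H (cycles_of_mapping n f))
    = (\<Sum>f | f \<in> M \<and> core n f = A. \<Sum>p | p permutes A. H (perm_cycles A p))"
proof (cases "A \<subseteq> {1..n}")
  case A: True
  define MA where "MA = {f \<in> M. core n f = A}"
  have finA: "finite A" using A finite_subset by blast
  have comp: "f \<circ> p \<in> MA" if "f \<in> MA" "p permutes A" for f p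
    using that core_compose(1)[of f k n p] zero_k_mappings_compose[of f k n p]
      permutes_subset[OF that(2) A] by (auto simp: MA_def M_def)
  have shift: "(\<Sum>f\<in>MA. H (cycles_of_mapping n f)) = (\<Sum>f\<in>MA. H (cycles_of_mapping n (f \<circ> p)))"
    if p: "p permutes A" for p
    by (rule sum.reindex_bij_witness[of _ "\<lambda>f. f \<circ> p" "\<lambda>f. f \<circ> inv p"])
       (auto intro: comp p permutes_inv simp: o_assoc[symmetric] permutes_inv_o[OF p])
  have inner: "(\<Sum>p | p permutes A. H (cycles_of_mapping n (f \<circ> p))) = (\<Sum>p | p permutes A. H (perm_cycles A p))"
    if f: "f \<in> MA" for f
  proof -
    have f': "f \<in> zero_k_mappings k n" "core n f = A" using f by (auto simp: MA_def M_def)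
    have "(\<Sum>p | p permutes A. H (cycles_of_mapping n (f \<circ> p)))
      = (\<Sum>p | p permutes A. H (perm_cycles A (perm_restrict f A \<circ> p)))"
      using core_compose[OF f'(1)] f'(2) by (intro sum.cong) (auto simp: cycles_of_mapping_core)
    also have "\<dots> = (\<Sum>p | p permutes A. H (perm_cycles A p))"
    proof -
      let ?q = "perm_restrict f A"
      have q: "?q permutes A" using perm_restrict_core[OF f'(1)] by (simp only: f'(2))
      show ?thesis
        by (rule sum.reindex_bij_witness[of _ "\<lambda>p. inv ?q \<circ> p" "\<lambda>p. ?q \<circ> p"])
           (auto simp: o_assoc permutes_inv_o[OF q] intro: permutes_compose q permutes_inv)
    qed
    finally show ?thesis .
  qed
  have "fact (card A) * (\<Sum>f\<in>MA. H (cycles_of_mapping n f))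
     = (\<Sum>p | p permutes A. \<Sum>f\<in>MA. H (cycles_of_mapping n f))"
    using card_permutations[OF refl finA] by simp
  also have "\<dots> = (\<Sum>p | p permutes A. \<Sum>f\<in>MA. H (cycles_of_mapping n (f \<circ> p)))"
    by (rule sum.cong[OF refl]) (rule shift, simp)
  also have "\<dots> = (\<Sum>f\<in>MA. \<Sum>p | p permutes A. H (cycles_of_mapping n (f \<circ> p)))"
    by (rule sum.swap)
  also have "\<dots> = (\<Sum>f\<in>MA. \<Sum>p | p permutes A. H (perm_cycles A p))"
    by (rule sum.cong[OF refl]) (rule inner)
  finally show ?thesis by (simp only: MA_def)
next
  case False
  then have "{f. f \<in> M \<and> core n f = A} = {}" using core_subset by auto
  then show ?thesis by (simp only: sum.empty mult_zero_right)
qed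

text \<open>Permutation averages that depend on the set only through its size pass to mappings:
  split by the core and symmetrise on each one. The uses are \<open>cexp\<close> and the sum of
  squared cycle lengths.\<close>

lemma sum_mappings_core:
  fixes H :: "nat set set \<Rightarrow> real"
  assumes "\<And>A. finite A \<Longrightarrow> (\<Sum>p | p permutes A. H (perm_cycles A p)) = fact (card A) * K (card A)"
  shows "(\<Sum>f\<in>zero_k_mappings k n. H (cycles_of_mapping n f)) = (\<Sum>f\<in>zero_k_mappings k n. K (card (core n f)))"
proof -
  let ?M = "zero_k_mappings k n"
  have "(\<Sum>f | f \<in> ?M \<and> core n f = A. H (cycles_of_mapping n f))
      = (\<Sum>f | f \<in> ?M \<and> core n f = A. K (card (core n f)))" if "A \<in> Pow {1..n}" for A
  proof -
    have "finite A" using that finite_subset by auto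
    then have "fact (card A) * (\<Sum>f | f \<in> ?M \<and> core n f = A. H (cycles_of_mapping n f))
      = fact (card A) * (\<Sum>f | f \<in> ?M \<and> core n f = A. K (card (core n f)))"
      unfolding sum_core_symmetrize by (simp add: assms sum_distrib_left)
    then show ?thesis by simp
  qed
  note eq = this
  have sub: "core n ` ?M \<subseteq> Pow {1..n}" using core_subset by auto
  have "(\<Sum>f\<in>?M. H (cycles_of_mapping n f))
      = (\<Sum>A\<in>Pow {1..n}. \<Sum>f | f \<in> ?M \<and> core n f = A. H (cycles_of_mapping n f))"
    using sub by (intro sum.group[symmetric]) auto
  also have "\<dots> = (\<Sum>A\<in>Pow {1..n}. \<Sum>f | f \<in> ?M \<and> core n f = A. K (card (core n f)))"
    by (intro sum.cong refl eq)
  also have "\<dots> = (\<Sum>f\<in>?M. K (card (core n f)))"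
    using sub by (intro sum.group) auto
  finally show ?thesis .
qed

lemma finite_cycles_of_mapping [simp]: "finite (cycles_of_mapping n f)"
  unfolding cycles_of_mapping_def by (rule finite_subset[of _ "Pow {1..n}"]) auto

lemma ln_cycle_product: "ln (real (cycle_product n f)) = (\<Sum>C\<in>cycles_of_mapping n f. ln (real (card C)))"
proof -
  have "card C > 0" if "C \<in> cycles_of_mapping n f" for C
    using that finite_cyclic_on[of f C] cyclic_on_nonempty[of f C]
    by (auto simp: cycles_of_mapping_def card_gt_0_iff)
  then show ?thesis
    unfolding cycle_product_def of_nat_prod by (intro ln_prod) auto
qed

lemma sum_mappings_log_cycle_product:
  "(\<Sum>f\<in>zero_k_mappings k n. g (ln (real (cycle_product n f))))
    = (\<Sum>f\<in>zero_k_mappings k n. cexp (card (core n f)) g)"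
  unfolding ln_cycle_product
  using sum_mappings_core[where H = "\<lambda>S. g (\<Sum>C\<in>S. ln (real (card C)))" and K = "\<lambda>m. cexp m g"]
  by (simp add: sum_permutes_log_cycles)

lemma sum_mappings_card_sq:
  "(\<Sum>f\<in>zero_k_mappings k n. \<Sum>C\<in>cycles_of_mapping n f. real (card C) ^ 2)
    = (\<Sum>f\<in>zero_k_mappings k n. real (card (core n f)) * (real (card (core n f)) + 1) / 2)"
  using sum_mappings_core[where H = "\<lambda>S. \<Sum>C\<in>S. real (card C) ^ 2" and K = "\<lambda>m. real m * (real m + 1) / 2"]
  by (simp add: sum_permutes_card_sq)

text \<open>A cyclic point has a preimage, so its fibre is full; as \<open>f\<close> is bijective on
  the core, exactly one of the \<open>k\<close> preimages is cyclic. The other \<open>k - 1\<close>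
  are the source of \<lambda> in the estimates.\<close>

lemma card_fibre_core:
  assumes "f \<in> zero_k_mappings k n" "z \<in> core n f"
  shows "card {y \<in> {1..n}. f y = z} = k"
    and "card {y \<in> {1..n}. f y = z \<and> y \<notin> core n f} = k - 1"
proof -
  obtain x where x: "x \<in> core n f" "f x = z"
    using bij_betw_core[OF assms(1)] assms(2) unfolding bij_betw_def by (metis imageE)
  have xin: "x \<in> {y \<in> {1..n}. f y = z}" using x subsetD[OF core_subset x(1)] by simp
  have "z \<in> {1..n}" using subsetD[OF core_subset assms(2)] .
  then show card: "card {y \<in> {1..n}. f y = z} = k"
    using assms(1) xin card_gt_0_iff[of "{y \<in> {1..n}. f y = z}"] by (auto simp: zero_k_mappings_def)
  have "{y \<in> {1..n}. f y = z \<and> y \<notin> core n f} = {y \<in> {1..n}. f y = z} - {x}"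
    using x bij_betw_core[OF assms(1)] by (auto simp: bij_betw_def dest: inj_onD)
  then show "card {y \<in> {1..n}. f y = z \<and> y \<notin> core n f} = k - 1"
    using card xin by (simp add: card_Diff_singleton)
qed

lemma card_preimage_core:
  assumes "f \<in> zero_k_mappings k n"
  shows "card {y \<in> {1..n}. f y \<in> core n f} = k * card (core n f)"
proof -
  have "{y \<in> {1..n}. f y \<in> core n f} = (\<Union>z\<in>core n f. {y \<in> {1..n}. f y = z})" by auto
  also have "card \<dots> = (\<Sum>z\<in>core n f. card {y \<in> {1..n}. f y = z})"
    by (intro card_UN_disjoint) auto
  also have "\<dots> = (\<Sum>z\<in>core n f. k)"
    by (intro sum.cong refl card_fibre_core(1)[OF assms])
  finally show ?thesis by simp
qed

lemma card_core_le:
  assumes "f \<in> zero_k_mappings k (k * r)" "k > 0"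
  shows "card (core (k * r) f) \<le> r"
proof -
  have "k * card (core (k * r) f) \<le> card {1..k * r}"
    unfolding card_preimage_core[OF assms(1), symmetric] by (intro card_mono) auto
  then show ?thesis using assms(2) by simp
qed

lemma zero_k_mappings_nonempty:
  assumes "k > 0"
  shows "zero_k_mappings k (k * r) \<noteq> {}"
proof -
  \<comment> \<open>Blocks of \<open>k\<close> consecutive points are sent to one point each, so
    \<open>1..r\<close> have full fibres and all other points have none.\<close>
  define f where "f = (\<lambda>x. if x \<in> {1..k * r} then Suc ((x - 1) div k) else undefined)"
  have "f \<in> zero_k_mappings k (k * r)"
    unfolding zero_k_mappings_def
  proof (intro CollectI conjI ballI PiE_I)
    fix x assume x: "x \<in> {1..k * r}"
    then have "x - 1 < r * k" by (auto simp: mult.commute)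
    then have "(x - 1) div k < r" by (simp add: less_mult_imp_div_less)
    moreover have "r \<le> k * r" using assms by simp
    ultimately have "Suc ((x - 1) div k) \<le> k * r" by linarith
    then show "f x \<in> {1..k * r}" using x by (simp add: f_def)
  next
    fix y assume y: "y \<in> {1..k * r}"
    show "card {x \<in> {1..k * r}. f x = y} \<in> {0, k}"
    proof (cases "y \<le> r")
      case True
      have "{x \<in> {1..k * r}. f x = y} = {Suc ((y - 1) * k)..y * k}"
      proof (intro equalityI subsetI)
        fix x assume x: "x \<in> {x \<in> {1..k * r}. f x = y}"
        then have "(x - 1) div k = y - 1" "x \<ge> 1" by (auto simp: f_def)
        then have "(y - 1) * k \<le> x - 1" "x - 1 < k + (y - 1) * k"
          using div_times_less_eq_dividend[of "x - 1" k] dividend_less_div_times[of k "x - 1"] assms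
          by simp_all
        moreover have "k + (y - 1) * k = y * k" using y by (cases y) auto
        ultimately show "x \<in> {Suc ((y - 1) * k)..y * k}"
          unfolding atLeastAtMost_iff using \<open>x \<ge> 1\<close> by linarith
      next
        fix x assume x: "x \<in> {Suc ((y - 1) * k)..y * k}"
        have "y * k \<le> k * r" using True by simp
        then have "x \<le> k * r" using x by (meson atLeastAtMost_iff le_trans)
        moreover have "(x - 1) div k = y - 1"
        proof (rule div_nat_eqI)
          have "Suc (y - 1) * k = y * k" using y by simp
          then show "x - 1 < k * Suc (y - 1)" using x by (auto simp: mult.commute)
          show "k * (y - 1) \<le> x - 1" using x by (auto simp: mult.commute)
        qed
        ultimately show "x \<in> {x \<in> {1..k * r}. f x = y}" using x y by (auto simp: f_def)
      qed
      moreover have "card {Suc ((y - 1) * k)..y * k} = k"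
        using y by (cases y) auto
      ultimately show ?thesis by simp
    next
      case False
      have "f x \<noteq> y" if "x \<in> {1..k * r}" for x
      proof -
        have "x - 1 < r * k" using that by (auto simp: mult.commute)
        then have "(x - 1) div k < r" by (simp add: less_mult_imp_div_less)
        then show ?thesis using that False by (auto simp: f_def)
      qed
      then show ?thesis by auto
    qed
  qed (auto simp: f_def)
  then show ?thesis by auto
qed

section \<open>Switching between paths and cycles\<close>

text \<open>The iterates \<open>x\<^sub>i\<close> of \<open>f\<close> at \<open>y\<close>, for \<open>i \<ge> 1\<close>, are distinct up to index \<open>q = rho_len f y\<close>, and the
  next one equals \<open>x\<^sub>c\<close> with \<open>c = rho_start f y\<close>. Exchanging the images of \<open>y\<close> and \<open>x\<^sub>q\<close> turns the whole
  path \<open>x\<^sub>1, \<dots>, x\<^sub>q\<close> into a cycle to which \<open>y\<close> is attached at \<open>x\<^sub>c\<close>. This switching is reversible once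
  the length \<open>q + 1 - c\<close> of the original cycle is recorded.\<close>

definition rho_len :: "('a \<Rightarrow> 'a) \<Rightarrow> 'a \<Rightarrow> nat" where
  "rho_len f y = (GREATEST q. inj_on (\<lambda>i. (f ^^ i) y) {1..q})"

definition rho_start :: "('a \<Rightarrow> 'a) \<Rightarrow> 'a \<Rightarrow> nat" where
  "rho_start f y = (LEAST c. c \<ge> 1 \<and> (f ^^ c) y = (f ^^ Suc (rho_len f y)) y)"

definition rho_cycle :: "('a \<Rightarrow> 'a) \<Rightarrow> 'a \<Rightarrow> nat" where
  "rho_cycle f y = Suc (rho_len f y) - rho_start f y"

definition rho_close :: "('a \<Rightarrow> 'a) \<Rightarrow> 'a \<Rightarrow> 'a \<Rightarrow> 'a" where
  "rho_close f y = f \<circ> Transposition.transpose y ((f ^^ rho_len f y) y)"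

lemma rho_len_eqI:
  assumes "inj_on (\<lambda>i. (f ^^ i) y) {1..q}" "c \<in> {1..q}" "(f ^^ c) y = (f ^^ Suc q) y"
  shows "rho_len f y = q"
  unfolding rho_len_def
proof (rule Greatest_equality)
  fix q' assume inj: "inj_on (\<lambda>i. (f ^^ i) y) {1..q'}"
  show "q' \<le> q"
  proof (rule ccontr)
    assume "\<not> q' \<le> q"
    then show False using inj_onD[OF inj assms(3)] assms(2) by auto
  qed
qed (rule assms(1))

lemma rho_props:
  assumes f: "f \<in> zero_k_mappings k n" and y: "y \<in> {1..n}"
  shows "inj_on (\<lambda>i. (f ^^ i) y) {1..rho_len f y}"
    and "rho_start f y \<in> {1..rho_len f y}"
    and "(f ^^ rho_start f y) y = (f ^^ Suc (rho_len f y)) y"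
proof -
  let ?P = "\<lambda>q. inj_on (\<lambda>i. (f ^^ i) y) {1..q}"
  have bound: "q \<le> n" if "?P q" for q
  proof -
    have "card {1..q} \<le> card {1..n}"
      using zero_k_mappings_funpow_in[OF f y] by (intro card_inj_on_le[OF that]) auto
    then show ?thesis by simp
  qed
  have "?P (rho_len f y)"
    unfolding rho_len_def by (rule GreatestI_nat[where k = 0 and b = n]) (use bound in auto)
  then show inj: "?P (rho_len f y)" .
  have not: "\<not> ?P (Suc (rho_len f y))"
  proof
    assume "?P (Suc (rho_len f y))"
    then have "Suc (rho_len f y) \<le> rho_len f y"
      unfolding rho_len_def by (rule Greatest_le_nat[where b = n]) (use bound in auto)
    then show False by simp
  qed
  have "{1..Suc (rho_len f y)} = insert (Suc (rho_len f y)) {1..rho_len f y}" by auto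
  then obtain c where c: "c \<in> {1..rho_len f y}" "(f ^^ c) y = (f ^^ Suc (rho_len f y)) y"
    using inj not by (auto simp del: funpow.simps)
  let ?Q = "\<lambda>c. c \<ge> 1 \<and> (f ^^ c) y = (f ^^ Suc (rho_len f y)) y"
  have Q: "?Q c" using c by (auto simp del: funpow.simps)
  have "?Q (rho_start f y)" unfolding rho_start_def by (rule LeastI[of ?Q, OF Q])
  moreover have "rho_start f y \<le> c" unfolding rho_start_def by (rule Least_le[of ?Q, OF Q])
  ultimately show "rho_start f y \<in> {1..rho_len f y}" "(f ^^ rho_start f y) y = (f ^^ Suc (rho_len f y)) y"
    using c(1) by (auto simp del: funpow.simps)
qed

text \<open>The points \<open>x_c, ..., x_q\<close> form the cycle reached from \<open>y\<close>;
  they are distinct and cyclic, and there are \<open>rho_cycle f y\<close> of them.\<close>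

lemma rho_cycle_le_card_core:
  assumes f: "f \<in> zero_k_mappings k n" and y: "y \<in> {1..n}"
  shows "1 \<le> rho_cycle f y" "rho_cycle f y \<le> card (core n f)"
proof -
  define q c where "q = rho_len f y" and "c = rho_start f y"
  note props = rho_props[OF f y, folded q_def c_def]
  have cq: "1 \<le> c" "c \<le> q" using props(2) by auto
  have len: "rho_cycle f y = Suc q - c" by (simp add: rho_cycle_def q_def c_def)
  have "(\<lambda>i. (f ^^ i) y) ` {c..q} \<subseteq> core n f"
  proof clarify
    fix i assume i: "i \<in> {c..q}"
    have "(f ^^ (Suc q - c)) ((f ^^ i) y) = (f ^^ (i - c)) ((f ^^ Suc q) y)"
    proof -
      have "Suc q - c + i = i - c + Suc q" using i cq by auto
      then show ?thesis by (metis comp_apply funpow_add)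
    qed
    also have "\<dots> = (f ^^ (i - c)) ((f ^^ c) y)" by (simp only: props(3))
    also have "\<dots> = (f ^^ i) y"
      using i by (simp flip: funpow_add comp_apply[of "f ^^ _" "f ^^ _"] del: funpow.simps comp_apply)
    finally have "(f ^^ i) y \<in> orbit f ((f ^^ i) y)"
      using cq unfolding orbit_altdef by (intro CollectI exI[of _ "Suc q - c"]) auto
    then show "(f ^^ i) y \<in> core n f"
      using zero_k_mappings_funpow_in[OF f y] by (simp add: core_def)
  qed
  moreover have "inj_on (\<lambda>i. (f ^^ i) y) {c..q}"
    using props(1) cq by (auto intro: inj_on_subset)
  ultimately have "card {c..q} \<le> card (core n f)"
    by (intro card_inj_on_le[of "\<lambda>i. (f ^^ i) y"]) auto
  then show "rho_cycle f y \<le> card (core n f)" "1 \<le> rho_cycle f y" using len cq by auto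
qed

text \<open>If \<open>y\<close> is cyclic then \<open>x_q = y\<close> and the exchange is void;
  counting iterates from 1 covers this case without a distinction. The last claim makes the
  switching reversible: the new mapping sends \<open>y\<close> to \<open>x_c\<close>, and
  \<open>q - c\<close> further steps lead to \<open>x_q\<close>, so the old cycle length locates the
  point to exchange back.\<close>

lemma rho_close_props:
  assumes f: "f \<in> zero_k_mappings k n" and y: "y \<in> {1..n}"
  shows "rho_close f y \<in> zero_k_mappings k n"
    and "rho_close f y y \<in> core n (rho_close f y)"
    and "(rho_close f y ^^ rho_cycle f y) y = (f ^^ rho_len f y) y"
proof -
  define q c x g where "q = rho_len f y" and "c = rho_start f y" and "x = (f ^^ q) y" and "g = rho_close f y"
  note props = rho_props[OF f y, folded q_def c_def]
  have cq: "1 \<le> c" "c \<le> q" using props(2) by auto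
  have g: "g = f \<circ> Transposition.transpose y x" by (simp add: g_def rho_close_def x_def q_def)
  have xin: "x \<in> {1..n}" unfolding x_def by (rule zero_k_mappings_funpow_in[OF f y])
  show gM: "g \<in> zero_k_mappings k n"
    unfolding g by (intro zero_k_mappings_compose f permutes_swap_id y xin)
  have step: "g ((f ^^ i) y) = (f ^^ Suc i) y" if i: "1 \<le> i" "i < q" for i
  proof -
    have "(f ^^ i) y \<noteq> x"
      using inj_onD[OF props(1), of i q] i unfolding x_def by auto
    moreover have "(f ^^ i) y \<noteq> y"
    proof
      assume eq: "(f ^^ i) y = y"
      have "(f ^^ Suc i) y = (f ^^ 1) y" using eq by simp
      then show False using inj_onD[OF props(1), of "Suc i" 1] i by auto
    qed
    ultimately show ?thesis by (simp add: g transpose_def)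
  qed
  have path: "(g ^^ i) (f y) = (f ^^ Suc i) y" if "i < q" for i
    using that
  proof (induction i)
    case (Suc i)
    then show ?case using step[of "Suc i"] by simp
  qed simp
  have gx: "g x = f y" by (simp add: g)
  have close: "(g ^^ q) (f y) = f y"
  proof -
    have "(g ^^ q) (f y) = g ((g ^^ (q - 1)) (f y))" using cq by (cases q) auto
    also have "\<dots> = g x" using path[of "q - 1"] cq by (simp add: x_def)
    finally show ?thesis by (simp add: gx)
  qed
  have gy: "g y = (f ^^ c) y"
    using props(3) by (simp add: g x_def)
  have c_eq: "(f ^^ c) y = (g ^^ (c - 1)) (f y)"
    using path[of "c - 1"] cq by simp
  show "g y \<in> core n g"
  proof -
    have "(g ^^ q) (g y) = g y"
      unfolding gy c_eq by (metis add.commute close comp_apply funpow_add)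
    then have "g y \<in> orbit g (g y)"
      using cq unfolding orbit_altdef by (intro CollectI exI[of _ q]) auto
    then show ?thesis using zero_k_mappings_in[OF gM y] by (simp add: core_def)
  qed
  have "rho_cycle f y = Suc (q - c)" using cq by (simp add: rho_cycle_def q_def c_def)
  then have "(g ^^ rho_cycle f y) y = (g ^^ (q - c)) (g y)"
    by (simp only: funpow_Suc_right comp_apply)
  also have "\<dots> = (g ^^ (q - c)) ((g ^^ (c - 1)) (f y))" by (simp only: gy c_eq)
  also have "\<dots> = (g ^^ ((q - c) + (c - 1))) (f y)" by (simp only: funpow_add comp_apply)
  also have "(q - c) + (c - 1) = q - 1" using cq by simp
  also have "(g ^^ (q - 1)) (f y) = (f ^^ q) y" using path[of "q - 1"] cq by simp
  finally show "(g ^^ rho_cycle f y) y = (f ^^ q) y" .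
qed

text \<open>With the cycle length \<open>j\<close> fixed, switching is injective. It lands in pairs
  of a mapping and a vertex \<open>y\<close> whose image is cyclic, and a mapping has
  \<open>k\<close> times as many such \<open>y\<close> as cyclic points.\<close>

lemma card_rho_cycle_le:
  fixes k n :: nat
  defines "M \<equiv> zero_k_mappings k n"
  shows "card {(f, y). f \<in> M \<and> y \<in> {1..n} \<and> rho_cycle f y = j} \<le> k * (\<Sum>f\<in>M. card (core n f))"
proof -
  let ?S = "{(f, y). f \<in> M \<and> y \<in> {1..n} \<and> rho_cycle f y = j}"
  let ?T = "Sigma M (\<lambda>f. {y \<in> {1..n}. f y \<in> core n f})"
  let ?h = "\<lambda>(f, y). (rho_close f y, y)"
  have inj: "inj_on ?h ?S"
  proof (rule inj_on_inverseI[where g = "\<lambda>(f, y). (f \<circ> Transposition.transpose y ((f ^^ j) y), y)"])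
    fix z assume z: "z \<in> ?S"
    obtain f y where fy: "z = (f, y)" by (cases z)
    have "f \<in> zero_k_mappings k n" "y \<in> {1..n}" "rho_cycle f y = j" using z fy M_def by auto
    then have "(rho_close f y ^^ j) y = (f ^^ rho_len f y) y" using rho_close_props(3) by blast
    then have "rho_close f y \<circ> Transposition.transpose y ((rho_close f y ^^ j) y) = f"
      by (simp add: rho_close_def comp_assoc)
    then show "(case ?h z of (f, y) \<Rightarrow> (f \<circ> Transposition.transpose y ((f ^^ j) y), y)) = z" by (simp add: fy)
  qed
  have "card ?S \<le> card ?T"
  proof (rule card_inj_on_le[OF inj])
    show "?h ` ?S \<subseteq> ?T"
      unfolding M_def using rho_close_props by fastforce
    show "finite ?T" by (intro finite_SigmaI) (auto simp: M_def)
  qed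
  also have "card ?T = (\<Sum>f\<in>M. card {y \<in> {1..n}. f y \<in> core n f})"
    by (subst card_SigmaI) (auto simp: M_def)
  also have "\<dots> = (\<Sum>f\<in>M. k * card (core n f))"
    by (rule sum.cong[OF refl]) (simp only: M_def card_preimage_core)
  finally show ?thesis by (simp only: sum_distrib_left)
qed

text \<open>This opens a cycle: when a non-cyclic \<open>y\<close> is attached to it, any point of
  the cycle may be chosen as the end of the path. After the exchange the path from \<open>y\<close>
  runs once through the whole cycle, starting just behind the chosen point, and then repeats. Each
  admissible \<open>j\<close> thus gives a preimage of \<open>g\<close> under switching.\<close>

lemma rho_close_inverse:
  assumes g: "g \<in> zero_k_mappings k n" and y: "y \<in> {1..n}" "y \<notin> core n g" "g y \<in> core n g"
    and j: "1 \<le> j" "j \<le> card (orbit g (g y))"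
  defines "f \<equiv> g \<circ> Transposition.transpose y ((g ^^ j) y)"
  shows "f \<in> zero_k_mappings k n" "rho_close f y = g" "(f ^^ rho_len f y) y = (g ^^ j) y"
proof -
  define z l where "z = g y" and "l = card (orbit g (g y))"
  have self: "z \<in> orbit g z" using y by (simp add: core_def z_def)
  have l: "l = funpow_dist1 g z z"
    unfolding l_def z_def[symmetric] orbit_conv_funpow_dist1[OF self]
    by (subst card_image[OF inj_on_funpow_dist1[OF self]]) simp
  have period: "(g ^^ l) z = z" unfolding l by (rule funpow_dist1_prop[OF self])
  have inj: "a mod l = b mod l" if "(g ^^ a) z = (g ^^ b) z" for a b
  proof -
    have "(g ^^ (a mod l)) z = (g ^^ (b mod l)) z" using that by (simp add: funpow_mod_eq[OF period])
    moreover have "l > 0" by (simp add: l)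
    ultimately show ?thesis
      using inj_onD[OF inj_on_funpow_dist1[OF self], of "a mod l" "b mod l"] by (simp flip: l)
  qed
  have jl: "j \<le> l" using j l_def by simp
  have yz: "(g ^^ i) y = (g ^^ (i - 1)) z" if "i \<ge> 1" for i
    using that by (cases i) (auto simp: z_def funpow_Suc_right simp del: funpow.simps)
  have core: "(g ^^ i) y \<in> core n g" if "i \<ge> 1" for i
  proof -
    have "(g ^^ (i - 1)) z \<in> orbit g z" by (rule funpow_in_orbit[OF self])
    then show ?thesis using core_closed(2)[OF g y(3)] yz[OF that] by (auto simp: z_def)
  qed
  have jin: "(g ^^ j) y \<in> {1..n}" by (rule zero_k_mappings_funpow_in[OF g y(1)])
  show fM: "f \<in> zero_k_mappings k n"
    unfolding f_def by (intro zero_k_mappings_compose g permutes_swap_id y jin)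
  have per_j: "(g ^^ (j + l)) y = (g ^^ j) y"
  proof -
    have "(g ^^ (j + l)) y = (g ^^ (j - 1)) ((g ^^ l) z)"
      using yz[of "j + l"] j by (simp flip: funpow_add comp_apply[of "g ^^ _" "g ^^ _"] del: comp_apply)
    then show ?thesis using yz[of j] j by (simp add: period)
  qed
  have step: "f ((g ^^ (j + i)) y) = (g ^^ (j + Suc i)) y" if i: "1 \<le> i" "i < l" for i
  proof -
    have "(g ^^ (j + i)) y \<noteq> y" using core[of "j + i"] y(2) i by auto
    moreover have "(g ^^ (j + i)) y \<noteq> (g ^^ j) y"
    proof
      assume "(g ^^ (j + i)) y = (g ^^ j) y"
      then have "(j - 1 + i) mod l = (j - 1) mod l"
        using yz[of "j + i"] yz[of j] j by (intro inj) (simp add: add.commute)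
      then have "l dvd i" by (metis add_diff_cancel_left' le_add1 mod_eq_dvd_iff_nat)
      then show False using i by (auto dest: dvd_imp_le)
    qed
    ultimately show ?thesis by (simp add: f_def transpose_def)
  qed
  have path: "(f ^^ i) y = (g ^^ (j + i)) y" if "1 \<le> i" "i \<le> l" for i
    using that
  proof (induction i rule: nat_induct_at_least)
    case base
    show ?case by (simp add: f_def)
  next
    case (Suc i)
    then show ?case using step[of i] by simp
  qed
  have l1: "l \<ge> 1" using j jl by simp
  have len: "rho_len f y = l"
  proof (rule rho_len_eqI)
    show "inj_on (\<lambda>i. (f ^^ i) y) {1..l}"
    proof (rule linorder_inj_onI')
      fix a b assume ab: "a \<in> {1..l}" "b \<in> {1..l}" "a < b"
      show "(f ^^ a) y \<noteq> (f ^^ b) y"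
      proof
        assume "(f ^^ a) y = (f ^^ b) y"
        then have "(g ^^ (j + a)) y = (g ^^ (j + b)) y" using path ab by simp
        then have "(j + b - 1) mod l = (j + a - 1) mod l"
          using yz[of "j + a"] yz[of "j + b"] j by (intro inj) simp
        then have "l dvd b - a" using ab mod_eq_dvd_iff_nat[of "j + a - 1" "j + b - 1" l] j by simp
        then show False using ab by (auto dest: dvd_imp_le)
      qed
    qed
    \<comment> \<open>The chosen point is sent to \<open>g y\<close>, which equals the iterate of
      \<open>g\<close> at \<open>y\<close> with index \<open>l + 1 = j + (l - j + 1)\<close>; so the
      repetition occurs at index \<open>l - j + 1\<close> of the new path.\<close>
    show "l - j + 1 \<in> {1..l}" using j jl by auto
    have "(f ^^ (l - j + 1)) y = (g ^^ (l + 1)) y" using path[of "l - j + 1"] j jl by simp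
    also have "\<dots> = z" using yz[of "l + 1"] period by simp
    also have "z = f ((g ^^ j) y)" by (simp add: f_def z_def)
    also have "(g ^^ j) y = (f ^^ l) y" using path[of l] l1 per_j by simp
    finally show "(f ^^ (l - j + 1)) y = (f ^^ Suc l) y" by simp
  qed
  show last: "(f ^^ rho_len f y) y = (g ^^ j) y" unfolding len using path[of l] l1 per_j by simp
  show "rho_close f y = g"
    unfolding rho_close_def last by (simp add: f_def comp_assoc)
qed

lemma sum_card_orbit_core:
  assumes f: "f \<in> zero_k_mappings k n"
  shows "(\<Sum>z\<in>core n f. card (orbit f z)) = (\<Sum>C\<in>cycles_of_mapping n f. card C ^ 2)"
proof -
  have core: "core n f = \<Union>(cycles_of_mapping n f)"
  proof (intro equalityI subsetI)
    fix x assume x: "x \<in> core n f"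
    then have "x \<in> orbit f x" by (simp add: core_def)
    moreover have "orbit f x \<in> cycles_of_mapping n f"
      using core_closed(2)[OF f x] core_subset[of n f] cyclic_on_orbit_self[OF \<open>x \<in> orbit f x\<close>]
      by (simp only: cycles_of_mapping_def mem_Collect_eq) (meson order_trans)
    ultimately show "x \<in> \<Union>(cycles_of_mapping n f)" by blast
  next
    fix x assume "x \<in> \<Union>(cycles_of_mapping n f)"
    then obtain C where C: "C \<subseteq> {1..n}" "cyclic_on f C" "x \<in> C" by (auto simp: cycles_of_mapping_def)
    then show "x \<in> core n f" using orbit_cyclic_eq3[OF C(2,3)] by (auto simp: core_def)
  qed
  have "(\<Sum>z\<in>core n f. card (orbit f z)) = (\<Sum>C\<in>cycles_of_mapping n f. \<Sum>z\<in>C. card (orbit f z))"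
    unfolding core
    by (subst sum.Union_disjoint)
       (auto simp: cycles_of_mapping_def intro: finite_cyclic_on dest: cyclic_on_disjoint)
  also have "\<dots> = (\<Sum>C\<in>cycles_of_mapping n f. card C ^ 2)"
    by (intro sum.cong[OF refl]) (auto simp: cycles_of_mapping_def power2_eq_square orbit_cyclic_eq3)
  finally show ?thesis .
qed

text \<open>Each cyclic point has \<open>k - 1\<close> non-cyclic preimages, and each of these
  admits as many openings as its cycle has points, so a cycle \<open>C\<close> accounts for
  \<open>(k - 1) * card C ^ 2\<close> triples. Opening is injective into pairs of a mapping and a
  vertex: closing recovers \<open>f\<close>, and the end of the path recovers
  \<open>j\<close>.\<close>

lemma sum_card_sq_cycles_le:
  fixes k n :: nat
  defines "M \<equiv> zero_k_mappings k n"
  shows "(k - 1) * (\<Sum>f\<in>M. \<Sum>C\<in>cycles_of_mapping n f. card C ^ 2) \<le> n * card M"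
proof -
  let ?Y = "\<lambda>f. {y \<in> {1..n}. y \<notin> core n f \<and> f y \<in> core n f}"
  let ?S = "Sigma M (\<lambda>f. Sigma (?Y f) (\<lambda>y. {1..card (orbit f (f y))}))"
  let ?h = "\<lambda>(f, y, j). (f \<circ> Transposition.transpose y ((f ^^ j) y), y)"
  have fib: "(\<Sum>y\<in>?Y f. card (orbit f (f y))) = (k - 1) * (\<Sum>C\<in>cycles_of_mapping n f. card C ^ 2)"
    if "f \<in> M" for f
  proof -
    have f: "f \<in> zero_k_mappings k n" using that by (simp add: M_def)
    have "(\<Sum>y\<in>?Y f. card (orbit f (f y)))
      = (\<Sum>z\<in>core n f. \<Sum>y | y \<in> ?Y f \<and> f y = z. card (orbit f (f y)))"
      by (rule sum.group[symmetric]) auto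
    also have "\<dots> = (\<Sum>z\<in>core n f. (k - 1) * card (orbit f z))"
    proof (rule sum.cong[OF refl])
      fix z assume z: "z \<in> core n f"
      have "{y. y \<in> ?Y f \<and> f y = z} = {y \<in> {1..n}. f y = z \<and> y \<notin> core n f}" using z by auto
      then have "card {y. y \<in> ?Y f \<and> f y = z} = k - 1" by (simp only: card_fibre_core(2)[OF f z])
      moreover have "(\<Sum>y | y \<in> ?Y f \<and> f y = z. card (orbit f (f y)))
          = (\<Sum>y | y \<in> ?Y f \<and> f y = z. card (orbit f z))"
        by (rule sum.cong[OF refl]) (simp only: mem_Collect_eq)
      ultimately show "(\<Sum>y | y \<in> ?Y f \<and> f y = z. card (orbit f (f y))) = (k - 1) * card (orbit f z)"
        by (simp only: sum_constant of_nat_id)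
    qed
    finally show ?thesis by (simp only: sum_distrib_left[symmetric] sum_card_orbit_core[OF f])
  qed
  have inj: "inj_on ?h ?S"
  proof (rule inj_onI)
    fix u v assume uv: "u \<in> ?S" "v \<in> ?S" "?h u = ?h v"
    obtain f y j where u: "u = (f, y, j)" by (cases u)
    obtain f' y' j' where v: "v = (f', y', j')" by (cases v)
    define g where "g = f \<circ> Transposition.transpose y ((f ^^ j) y)"
    have yy: "y' = y" and gg: "g = f' \<circ> Transposition.transpose y ((f' ^^ j') y)"
      using uv(3) by (auto simp: u v g_def)
    have fy: "f \<in> zero_k_mappings k n" "y \<in> {1..n}" "y \<notin> core n f" "f y \<in> core n f"
        "1 \<le> j" "j \<le> card (orbit f (f y))"
      and fy': "f' \<in> zero_k_mappings k n" "y \<in> {1..n}" "y \<notin> core n f'" "f' y \<in> core n f'"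
        "1 \<le> j'" "j' \<le> card (orbit f' (f' y))"
      using uv(1,2) unfolding u v yy M_def by auto
    note inv = rho_close_inverse[OF fy, folded g_def] rho_close_inverse[OF fy', folded gg]
    have ff: "f' = f" using inv(2,5) by simp
    have "(f ^^ j) y = (f ^^ j') y" using inv(3,6) ff by simp
    define z where "z = f y"
    have self: "z \<in> orbit f z" using fy by (simp add: core_def z_def)
    have l: "card (orbit f z) = funpow_dist1 f z z"
      by (subst orbit_conv_funpow_dist1[OF self], subst card_image[OF inj_on_funpow_dist1[OF self]]) simp
    have "(f ^^ (j - 1)) z = (f ^^ (j' - 1)) z"
      using \<open>(f ^^ j) y = (f ^^ j') y\<close> fy(5) fy'(5)
      by (cases j; cases j') (auto simp: z_def funpow_Suc_right simp del: funpow.simps)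
    then have "j - 1 = j' - 1"
      using inj_onD[OF inj_on_funpow_dist1[OF self], of "j - 1" "j' - 1"] fy(5,6) fy'(5,6) ff l
      unfolding z_def by auto
    then show "u = v" using fy(5) fy'(5) by (simp add: u v ff yy)
  qed
  have "(k - 1) * (\<Sum>f\<in>M. \<Sum>C\<in>cycles_of_mapping n f. card C ^ 2) = (\<Sum>f\<in>M. \<Sum>y\<in>?Y f. card (orbit f (f y)))"
    unfolding sum_distrib_left by (rule sum.cong[OF refl]) (simp only: fib sum_distrib_left)
  also have "\<dots> = card ?S"
    by (simp add: M_def)
  also have "\<dots> \<le> card (M \<times> {1..n})"
  proof (rule card_inj_on_le[OF inj])
    show "?h ` ?S \<subseteq> M \<times> {1..n}"
      unfolding M_def using rho_close_inverse(1) by fastforce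
  qed (simp add: M_def)
  finally show ?thesis by (simp add: card_cartesian_product mult.commute)
qed

section \<open>Second moment and small values of the number of cyclic points\<close>

text \<open>Given the core, the cycles are those of a uniform permutation, so their squared lengths
  sum to \<open>Z (Z + 1) / 2\<close> on average. This turns the switching count into a
  second-moment bound for \<open>Z\<close>.\<close>

lemma sum_core_sq_le:
  fixes k n :: nat
  defines "M \<equiv> zero_k_mappings k n"
  assumes "k \<ge> 1"
  shows "(real k - 1) * (\<Sum>f\<in>M. real (card (core n f)) * (real (card (core n f)) + 1) / 2) \<le> real n * real (card M)"
proof -
  have "real ((k - 1) * (\<Sum>f\<in>M. \<Sum>C\<in>cycles_of_mapping n f. card C ^ 2)) \<le> real (n * card M)"
    unfolding M_def of_nat_le_iff by (rule sum_card_sq_cycles_le)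
  then show ?thesis
    using assms(2) sum_mappings_card_sq[where k = k and n = n] by (simp add: M_def of_nat_diff)
qed

text \<open>The cycle reached from any vertex \<open>y\<close> has at most \<open>Z\<close> points,
  so \<open>w Z\<close> is at most \<open>w (rho_cycle f y)\<close> for all \<open>n\<close>
  vertices at once. Summing over \<open>y\<close> and grouping by cycle length reduces the claim to
  the switching count for each length.\<close>

lemma sum_antimono_core_le:
  fixes k n :: nat and w :: "nat \<Rightarrow> real"
  defines "M \<equiv> zero_k_mappings k n"
  assumes anti: "\<And>i j. 1 \<le> i \<Longrightarrow> i \<le> j \<Longrightarrow> w j \<le> w i" and nonneg: "\<And>i. w i \<ge> 0"
  shows "real n * (\<Sum>f\<in>M. w (card (core n f))) \<le> (\<Sum>j=1..n. w j) * (real k * (\<Sum>f\<in>M. real (card (core n f))))"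
proof -
  have finM: "finite M" by (simp add: M_def)
  have "real n * (\<Sum>f\<in>M. w (card (core n f))) = (\<Sum>f\<in>M. \<Sum>y=1..n. w (card (core n f)))"
    by (simp add: sum_distrib_left)
  also have "\<dots> \<le> (\<Sum>f\<in>M. \<Sum>y=1..n. w (rho_cycle f y))"
    unfolding M_def by (intro sum_mono anti rho_cycle_le_card_core)
  also have "\<dots> = (\<Sum>(f, y)\<in>M \<times> {1..n}. w (rho_cycle f y))"
    by (rule sum.cartesian_product)
  also have "\<dots> = (\<Sum>j=1..n. \<Sum>z | z \<in> M \<times> {1..n} \<and> (case z of (f, y) \<Rightarrow> rho_cycle f y) = j. case z of (f, y) \<Rightarrow> w (rho_cycle f y))"
  proof (rule sum.group[symmetric])
    show "(\<lambda>z. case z of (f, y) \<Rightarrow> rho_cycle f y) ` (M \<times> {1..n}) \<subseteq> {1..n}"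
    proof clarify
      fix f y assume fy: "f \<in> M" "y \<in> {1..n}"
      have "card (core n f) \<le> n" using card_mono[OF _ core_subset[of n f]] by simp
      then show "rho_cycle f y \<in> {1..n}"
        using rho_cycle_le_card_core[of f k n y] fy by (simp add: M_def)
    qed
  qed (simp_all add: finM)
  also have "\<dots> = (\<Sum>j=1..n. w j * real (card {(f, y). f \<in> M \<and> y \<in> {1..n} \<and> rho_cycle f y = j}))"
  proof (rule sum.cong[OF refl])
    fix j
    have set_eq: "{z. z \<in> M \<times> {1..n} \<and> (case z of (f, y) \<Rightarrow> rho_cycle f y) = j}
      = {(f, y). f \<in> M \<and> y \<in> {1..n} \<and> rho_cycle f y = j}" by auto
    have "(\<Sum>z\<in>{(f, y). f \<in> M \<and> y \<in> {1..n} \<and> rho_cycle f y = j}. case z of (f, y) \<Rightarrow> w (rho_cycle f y))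
       = (\<Sum>z\<in>{(f, y). f \<in> M \<and> y \<in> {1..n} \<and> rho_cycle f y = j}. w j)"
      by (rule sum.cong[OF refl]) auto
    then show "(\<Sum>z | z \<in> M \<times> {1..n} \<and> (case z of (f, y) \<Rightarrow> rho_cycle f y) = j. case z of (f, y) \<Rightarrow> w (rho_cycle f y))
      = w j * real (card {(f, y). f \<in> M \<and> y \<in> {1..n} \<and> rho_cycle f y = j})"
      unfolding set_eq by (simp only: sum_constant mult.commute)
  qed
  also have "\<dots> \<le> (\<Sum>j=1..n. w j * real (k * (\<Sum>f\<in>M. card (core n f))))"
    unfolding M_def by (intro sum_mono mult_left_mono nonneg of_nat_mono card_rho_cycle_le)
  finally show ?thesis by (simp add: sum_distrib_right)
qed

section \<open>Stein's equation for the normal distribution\<close>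

lemma std_normal_density_has_real_derivative [derivative_intros]:
  "(std_normal_density has_real_derivative - (x * std_normal_density x)) (at x)"
  unfolding std_normal_density_def
  by (auto intro!: derivative_eq_intros simp: field_simps power2_eq_square)

lemma continuous_on_std_normal_density [continuous_intros]: "continuous_on A std_normal_density"
  unfolding std_normal_density_def by (intro continuous_intros) auto

lemma std_normal_density_le_1: "std_normal_density x \<le> 1"
proof -
  have "1 \<le> sqrt (2 * pi)" using pi_ge_two by simp
  moreover have "exp (- x\<^sup>2 / 2) \<le> 1" by simp
  ultimately show ?thesis
    unfolding std_normal_density_def using mult_mono[of "1 / sqrt (2 * pi)" 1 "exp (- x\<^sup>2 / 2)" 1] by simp
qed

text \<open>Source of the constant 6: \<open>sqrt (2 * pi)\<close> is at most 3, and the exponential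
  is at least \<open>1 / 2\<close> on this interval.\<close>

lemma std_normal_density_ge: 
  assumes "\<bar>x\<bar> \<le> 1"
  shows "1 / 6 \<le> std_normal_density x"
proof -
  have "sqrt (2 * pi) \<le> sqrt 9" using pi_less_4 by (intro real_sqrt_le_mono) simp
  then have s: "1 / 3 \<le> 1 / sqrt (2 * pi)" by (intro divide_left_mono) auto
  have "x\<^sup>2 \<le> 1" using assms by (simp add: abs_square_le_1)
  then have e: "1 / 2 \<le> exp (- x\<^sup>2 / 2)"
    using exp_ge_add_one_self[of "- x\<^sup>2 / 2"] by linarith
  show ?thesis
    unfolding std_normal_density_def using mult_mono[OF s e] by simp
qed

lemma set_integrable_std_normal_density [simp]:
  "A \<in> sets borel \<Longrightarrow> set_integrable lborel A std_normal_density"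
  unfolding set_integrable_def by (rule integrable_mult_indicator) auto

lemma phi_eq: "phi x = (LBINT t:{..x}. std_normal_density t)"
  unfolding phi_def std_normal_density_def by (subst set_integral_mult_right[symmetric]) simp

lemma phi_uminus_eq: "phi (- w) = (LBINT t:{w..}. std_normal_density t)"
proof -
  have "phi (- w) = (\<integral>t. indicator {..-w} t *\<^sub>R std_normal_density t \<partial>lborel)"
    by (simp add: phi_eq set_lebesgue_integral_def)
  also have "\<dots> = (\<integral>t. indicator {..-w} (- t) *\<^sub>R std_normal_density (- t) \<partial>lborel)"
    by (subst lborel_integral_real_affine[where c = "-1" and t = 0]) simp_all
  also have "\<dots> = (\<integral>t. indicator {w..} t *\<^sub>R std_normal_density t \<partial>lborel)"
    by (intro Bochner_Integration.integral_cong refl) (auto simp: indicator_def std_normal_density_def)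
  finally show ?thesis by (simp add: set_lebesgue_integral_def)
qed

lemma phi_le_1: "phi x \<le> 1"
proof -
  have "phi x \<le> (\<integral>t. std_normal_density t \<partial>lborel)"
    unfolding phi_eq set_lebesgue_integral_def
    by (intro integral_mono integrable_mult_indicator) (auto simp: indicator_def)
  then show ?thesis by simp
qed

lemma std_normal_density_tendsto_0: "(std_normal_density \<longlongrightarrow> 0) at_top"
proof -
  have "filterlim (\<lambda>x::real. x\<^sup>2 / 2) at_top at_top"
    by (rule filterlim_at_top_mult_tendsto_pos[where c = "1/2" and f = "\<lambda>_. 1/2", simplified])
       (auto intro!: filterlim_pow_at_top filterlim_ident)
  then have "filterlim (\<lambda>x::real. - (x\<^sup>2 / 2)) at_bot at_top"
    by (simp add: filterlim_uminus_at_bot)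
  then have "((\<lambda>x::real. exp (- (x\<^sup>2 / 2))) \<longlongrightarrow> 0) at_top"
    by (rule filterlim_compose[OF exp_at_bot])
  then have "((\<lambda>x::real. 1 / sqrt (2 * pi) * exp (- (x\<^sup>2 / 2))) \<longlongrightarrow> 1 / sqrt (2 * pi) * 0) at_top"
    by (intro tendsto_mult tendsto_const)
  then show ?thesis unfolding std_normal_density_def by simp
qed

text \<open>On the tail \<open>t >= w\<close>, so the factor \<open>w\<close> may be replaced by
  \<open>t\<close> under the integral, and \<open>t\<close> times the density is the derivative of
  minus the density.\<close>

lemma Mills_ratio_le:
  assumes "w \<ge> 0"
  shows "w * phi (- w) \<le> std_normal_density w"
proof -
  let ?f = "\<lambda>t. t * std_normal_density t"
  have int: "integrable lborel ?f"
    using integrable_std_normal_moment[of 1] by (simp add: mult.commute)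
  then have int': "integrable lborel (\<lambda>t. indicator {w..} t *\<^sub>R ?f t)"
    by (intro integrable_mult_indicator) auto
  have "(\<integral>\<^sup>+ t. ennreal (?f t) * indicator {w..} t \<partial>lborel) = ennreal (0 - (- std_normal_density w))"
  proof (rule nn_integral_FTC_atLeast)
    show "((\<lambda>t. - std_normal_density t) \<longlongrightarrow> 0) at_top"
      using tendsto_minus[OF std_normal_density_tendsto_0] by simp
    fix t assume "w \<le> t"
    show "((\<lambda>t. - std_normal_density t) has_real_derivative ?f t) (at t)"
      using DERIV_minus[OF std_normal_density_has_real_derivative[of t]] by simp
    show "0 \<le> ?f t" using assms \<open>w \<le> t\<close> by simp
  qed simp
  moreover have "(\<integral>\<^sup>+ t. ennreal (?f t) * indicator {w..} t \<partial>lborel)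
      = (\<integral>\<^sup>+ t. ennreal (indicator {w..} t *\<^sub>R ?f t) \<partial>lborel)"
    by (intro nn_integral_cong) (auto simp: indicator_def)
  ultimately have "(\<integral>\<^sup>+ t. ennreal (indicator {w..} t *\<^sub>R ?f t) \<partial>lborel) = ennreal (std_normal_density w)"
    by simp
  then have eq: "(\<integral>t. indicator {w..} t *\<^sub>R ?f t \<partial>lborel) = std_normal_density w"
    using assms by (intro integral_eq_nn_integral[THEN trans] AE_I2) (auto simp: indicator_def)
  have "w * phi (- w) = (\<integral>t. w * (indicator {w..} t *\<^sub>R std_normal_density t) \<partial>lborel)"
    unfolding phi_uminus_eq set_lebesgue_integral_def by (rule Bochner_Integration.integral_mult_right_zero[symmetric])
  also have "\<dots> \<le> (\<integral>t. indicator {w..} t *\<^sub>R ?f t \<partial>lborel)"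
    using set_integrable_std_normal_density[of "{w..}"] int'
    by (intro integral_mono) (auto simp: indicator_def set_integrable_def mult_right_mono)
  finally show ?thesis using eq by simp
qed

lemma phi_uminus_le_density:
  assumes "w \<ge> 0"
  shows "phi (- w) \<le> 6 * std_normal_density w"
proof (cases "w \<le> 1")
  case True
  then show ?thesis using phi_le_1[of "- w"] std_normal_density_ge[of w] assms by simp
next
  case False
  have "0 \<le> phi (- w)" unfolding phi_uminus_eq set_lebesgue_integral_def by simp
  then have "1 * phi (- w) \<le> w * phi (- w)" using False by (intro mult_right_mono) auto
  then show ?thesis using Mills_ratio_le[OF assms] normal_density_nonneg[of 0 1 w] by linarith
qed

section \<open>The bounded solution of Stein's equation\<close>

lemma has_real_derivative_set_integral_atMost:
  fixes g :: "real \<Rightarrow> real"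
  assumes int: "integrable lborel g" and cont: "continuous_on UNIV g"
  shows "((\<lambda>w. LBINT t:{..w}. g t) has_real_derivative g w) (at w)"
proof -
  have sint: "set_integrable lborel A g" if "A \<in> sets borel" for A
    unfolding set_integrable_def using int that by (intro integrable_mult_indicator) auto
  \<comment> \<open>Splitting off the far tail as a constant leaves a compact window for the
    fundamental theorem of calculus.\<close>
  define K where "K = (LBINT t:{..<w - 1}. g t)"
  have "((\<lambda>u. integral {w - 1..u} g) has_real_derivative g w) (at w within {w - 1..w + 1})"
    by (rule integral_has_real_derivative) (auto intro: continuous_on_subset[OF cont])
  then have "((\<lambda>u. integral {w - 1..u} g) has_real_derivative g w) (at w)"
    by (subst (asm) at_within_Icc_at) auto
  then have "((\<lambda>u. K + integral {w - 1..u} g) has_real_derivative g w) (at w)"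
    by (auto intro!: derivative_eq_intros)
  then show ?thesis
  proof (rule has_field_derivative_transform_within_open)
    fix u assume u: "u \<in> {w - 1<..<w + 1}"
    have "{..u} = {..<w - 1} \<union> {w - 1..u}" using u by auto
    then have "(LBINT t:{..u}. g t) = K + (LBINT t:{w - 1..u}. g t)"
      unfolding K_def by (simp only:) (intro set_integral_Un sint, auto)
    also have "(LBINT t:{w - 1..u}. g t) = integral {w - 1..u} g"
      by (rule set_borel_integral_eq_integral(2)[OF sint]) simp
    finally show "K + integral {w - 1..u} g = (LBINT t:{..u}. g t)" by simp
  qed auto
qed

text \<open>The classical solution integrates \<open>h - \<theta>\<close> against the density up to
  \<open>w\<close> and divides by the density. As the full integral vanishes, \<open>G\<close> can
  be estimated over either half-line, and the smaller tail gives \<open>phi (- |w|)\<close>. The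
  tail bounds yield \<open>|f| <= 6\<close> and \<open>|w f| <= 1\<close>, and the equation itself
  then yields \<open>|f'| <= 2\<close>.\<close>

lemma stein_solution:
  fixes h :: "real \<Rightarrow> real"
  assumes cont: "continuous_on UNIV h" and h: "\<And>x. 0 \<le> h x" "\<And>x. h x \<le> 1"
  defines "\<theta> \<equiv> \<integral>t. h t * std_normal_density t \<partial>lborel"
  obtains f f' where
    "\<And>x. (f has_real_derivative f' x) (at x)" "\<And>x. f' x = x * f x + h x - \<theta>"
    "\<And>x. \<bar>f x\<bar> \<le> 6" "\<And>x. \<bar>f' x\<bar> \<le> 2"
proof -
  let ?d = std_normal_density
  have [measurable]: "h \<in> borel_measurable borel" by (rule borel_measurable_continuous_onI[OF cont])
  have hint: "integrable lborel (\<lambda>t. h t * ?d t)"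
  proof (rule Bochner_Integration.integrable_bound)
    show "integrable lborel ?d" by simp
    show "AE t in lborel. norm (h t * ?d t) \<le> norm (?d t)"
      using h by (auto simp: abs_mult mult_left_le_one_le)
  qed simp
  have "0 \<le> \<theta>" unfolding \<theta>_def using h by (intro Bochner_Integration.integral_nonneg) auto
  moreover have "\<theta> \<le> (\<integral>t. ?d t \<partial>lborel)"
    unfolding \<theta>_def using h by (intro integral_mono hint) (auto simp: mult_left_le_one_le)
  ultimately have \<theta>: "0 \<le> \<theta>" "\<theta> \<le> 1" by simp_all
  have h\<theta>: "\<bar>h x - \<theta>\<bar> \<le> 1" for x using h(1)[of x] h(2)[of x] \<theta> by linarith
  define g where "g t = (h t - \<theta>) * ?d t" for t
  have gint: "integrable lborel g"
    unfolding g_def left_diff_distrib using hint by (intro Bochner_Integration.integrable_diff) auto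
  have gcont: "continuous_on UNIV g"
    unfolding g_def by (intro continuous_intros cont)
  have g0: "(\<integral>t. g t \<partial>lborel) = 0"
    unfolding g_def left_diff_distrib using hint
    by (subst Bochner_Integration.integral_diff) (auto simp: \<theta>_def)
  have gd: "\<bar>g t\<bar> \<le> ?d t" for t
    unfolding g_def abs_mult using h\<theta>[of t] by (simp add: mult_left_le_one_le)
  have sint: "set_integrable lborel A g" if "A \<in> sets borel" for A
    unfolding set_integrable_def using gint that by (intro integrable_mult_indicator) auto
  have bound: "\<bar>LBINT t:A. g t\<bar> \<le> (LBINT t:A. ?d t)" if "A \<in> sets borel" for A
  proof -
    have "\<bar>LBINT t:A. g t\<bar> \<le> (LBINT t:A. \<bar>g t\<bar>)"
      using set_integral_norm_bound[OF sint[OF that]] by simp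
    also have "\<dots> \<le> (LBINT t:A. ?d t)"
      using that gd by (intro set_integral_mono set_integrable_abs sint) auto
    finally show ?thesis .
  qed
  define G where "G w = (LBINT t:{..w}. g t)" for w
  have G_lower: "\<bar>G w\<bar> \<le> phi w" for w
    unfolding G_def phi_eq by (rule bound) simp
  have G_upper: "\<bar>G w\<bar> \<le> phi (- w)" for w
  proof -
    have "(LBINT t:{..w} \<union> {w<..}. g t) = G w + (LBINT t:{w<..}. g t)"
      unfolding G_def by (intro set_integral_Un sint) auto
    moreover have "{..w} \<union> {w<..} = (UNIV :: real set)" by auto
    ultimately have "G w = - (LBINT t:{w<..}. g t)"
      using g0 by (simp add: set_lebesgue_integral_def)
    then have "\<bar>G w\<bar> \<le> (LBINT t:{w<..}. ?d t)" using bound[of "{w<..}"] by simp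
    also have "\<dots> \<le> phi (- w)"
      unfolding phi_uminus_eq set_lebesgue_integral_def
      using set_integrable_std_normal_density[of "{w<..}"] set_integrable_std_normal_density[of "{w..}"]
      by (intro integral_mono) (auto simp: set_integrable_def indicator_def)
    finally show ?thesis .
  qed
  define f where "f w = G w / ?d w" for w
  define f' where "f' w = w * f w + h w - \<theta>" for w
  have dpos: "?d w > 0" for w by (rule normal_density_pos) simp
  have sym: "?d \<bar>w\<bar> = ?d w" for w by (simp add: std_normal_density_def)
  have G_abs: "\<bar>G w\<bar> \<le> phi (- \<bar>w\<bar>)" for w
    using G_lower[of w] G_upper[of w] by (cases "w \<ge> 0") auto
  have f6: "\<bar>f w\<bar> \<le> 6" for w
    using order_trans[OF G_abs phi_uminus_le_density[of "\<bar>w\<bar>"]] dpos[of w]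
    by (simp add: f_def sym divide_le_eq)
  have wf: "\<bar>w * f w\<bar> \<le> 1" for w
  proof -
    have "\<bar>w\<bar> * \<bar>G w\<bar> \<le> \<bar>w\<bar> * phi (- \<bar>w\<bar>)" by (intro mult_left_mono G_abs) simp
    also have "\<dots> \<le> ?d w" using Mills_ratio_le[of "\<bar>w\<bar>"] by (simp add: sym)
    finally show ?thesis using dpos[of w] by (simp add: f_def abs_mult divide_le_eq)
  qed
  show ?thesis
  proof (rule that)
    show "(f has_real_derivative f' x) (at x)" for x
    proof -
      have "(G has_real_derivative g x) (at x)"
        unfolding G_def by (rule has_real_derivative_set_integral_atMost[OF gint gcont])
      from DERIV_divide[OF this std_normal_density_has_real_derivative[of x]] dpos[of x]
      have "(f has_real_derivative (g x * ?d x - G x * - (x * ?d x)) / (?d x * ?d x)) (at x)"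
        unfolding f_def by simp
      moreover have "(g x * ?d x - G x * - (x * ?d x)) / (?d x * ?d x) = f' x"
        using dpos[of x] by (simp add: f'_def f_def g_def field_simps)
      ultimately show ?thesis by simp
    qed
    show "\<bar>f' x\<bar> \<le> 2" for x
      using wf[of x] h\<theta>[of x] unfolding f'_def by linarith
  qed (use f6 f'_def in auto)
qed

lemma phi_diff_le:
  assumes "e \<ge> 0"
  shows "phi (x + e) \<le> phi x + e"
proof -
  have "{..x + e} = {..x} \<union> {x<..x + e}" using assms by auto
  then have "phi (x + e) = phi x + (LBINT t:{x<..x + e}. std_normal_density t)"
    unfolding phi_eq by (simp only:) (intro set_integral_Un set_integrable_std_normal_density, auto)
  also have "(LBINT t:{x<..x + e}. std_normal_density t) \<le> (LBINT t:{x<..x + e}. 1)"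
    using assms by (intro set_integral_mono set_integrable_std_normal_density)
       (auto simp: std_normal_density_le_1 set_integrable_def intro!: integrable_real_indicator)
  also have "\<dots> = e" using assms by (simp add: set_lebesgue_integral_def)
  finally show ?thesis by simp
qed

lemma integral_between_phi:
  fixes h :: "real \<Rightarrow> real"
  assumes [measurable]: "h \<in> borel_measurable borel" and "\<And>t. indicator {..x} t \<le> h t" "\<And>t. h t \<le> indicator {..y} t"
  shows "phi x \<le> (\<integral>t. h t * std_normal_density t \<partial>lborel)"
    and "(\<integral>t. h t * std_normal_density t \<partial>lborel) \<le> phi y"
proof -
  let ?d = std_normal_density
  have h: "0 \<le> h t" "h t \<le> 1" for t
    using order_trans[OF _ assms(2), of 0 t] order_trans[OF assms(3), of t 1] by simp_all
  have hint: "integrable lborel (\<lambda>t. h t * ?d t)"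
  proof (rule Bochner_Integration.integrable_bound)
    show "integrable lborel ?d" by simp
    show "AE t in lborel. norm (h t * ?d t) \<le> norm (?d t)"
      using h by (auto simp: abs_mult mult_left_le_one_le)
  qed simp
  have int: "integrable lborel (\<lambda>t. indicator {..z} t * ?d t)" for z :: real
    using set_integrable_std_normal_density[of "{..z}"] by (simp add: set_integrable_def)
  show "phi x \<le> (\<integral>t. h t * ?d t \<partial>lborel)" "(\<integral>t. h t * ?d t \<partial>lborel) \<le> phi y"
    unfolding phi_eq set_lebesgue_integral_def real_scaleR_def
    using assms(2,3) by (auto intro!: integral_mono hint int mult_right_mono)
qed

lemma cdf_std_normal_distribution: "cdf std_normal_distribution x = phi x"
proof -
  have "cdf std_normal_distribution x = (\<integral>t. indicator {..x} t \<partial>std_normal_distribution)"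
    by (simp add: cdf_def)
  also have "\<dots> = phi x"
    unfolding phi_eq set_lebesgue_integral_def by (subst integral_density) (auto simp: mult.commute)
  finally show ?thesis .
qed

section \<open>Kolmogorov distance\<close>

lemma sum_ln_pos_part_le:
  fixes s :: real
  assumes "s > 0"
  shows "(\<Sum>j=1..n. max 0 (ln (s / real j))) \<le> 4 * s"
proof -
  \<comment> \<open>From \<open>ln u = 2 ln (sqrt u) <= 2 sqrt u\<close> the summands are at most
    \<open>2 sqrt s / sqrt j\<close>, and \<open>1 / sqrt j\<close> telescopes. The minimum stops
    the growth at \<open>s\<close>, beyond which the summands vanish.\<close>
  have "(\<Sum>j=1..n. max 0 (ln (s / real j))) \<le> 4 * sqrt s * sqrt (min (real n) s)"
  proof (induction n)
    case 0
    then show ?case using assms by simp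
  next
    case (Suc n)
    show ?case
    proof (cases "real (Suc n) \<le> s")
      case True
      define u v where "u = sqrt (real n)" and "v = sqrt (real (Suc n))"
      have uv: "0 \<le> u" "u \<le> v" "v > 0" "v ^ 2 = real (Suc n)" "u ^ 2 = real n"
        by (auto simp: u_def v_def)
      have "ln (s / real (Suc n)) = 2 * ln (sqrt (s / real (Suc n)))"
        using assms by (subst ln_sqrt) auto
      also have "\<dots> \<le> 2 * sqrt (s / real (Suc n))"
      proof -
        have "0 < sqrt (s / real (Suc n))" using assms by simp
        from ln_less_self[OF this] show ?thesis by linarith
      qed
      also have "\<dots> = 2 * sqrt s * (1 / v)" by (simp add: v_def real_sqrt_divide)
      also have "1 / v \<le> 2 * (v - u)"
      proof -
        have "1 = v ^ 2 - u ^ 2" using uv by simp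
        also have "\<dots> = (v - u) * (v + u)" by (simp add: power2_eq_square algebra_simps)
        also have "\<dots> \<le> (v - u) * (2 * v)" using uv by (intro mult_left_mono) auto
        also have "\<dots> = 2 * (v - u) * v" by simp
        finally show ?thesis using uv(3) by (simp only: pos_divide_le_eq)
      qed
      finally have "ln (s / real (Suc n)) \<le> 4 * sqrt s * v - 4 * sqrt s * u"
        using assms by (simp add: algebra_simps)
      moreover have "0 \<le> 4 * sqrt s * v - 4 * sqrt s * u"
        using uv assms by (simp flip: right_diff_distrib)
      ultimately have "max 0 (ln (s / real (Suc n))) \<le> 4 * sqrt s * v - 4 * sqrt s * u" by simp
      moreover have "min (real n) s = real n" "min (real (Suc n)) s = real (Suc n)" using True by auto
      ultimately show ?thesis using Suc by (simp add: u_def v_def)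
    next
      case False
      then have "s / real (Suc n) \<le> 1" by simp
      then have "max 0 (ln (s / real (Suc n))) = 0" using assms by simp
      moreover have "4 * sqrt s * sqrt (min (real n) s) \<le> 4 * sqrt s * sqrt (min (real (Suc n)) s)"
        using assms by (intro mult_left_mono) auto
      ultimately show ?thesis using Suc by simp
    qed
  qed
  also have "\<dots> \<le> 4 * sqrt s * sqrt s" using assms by (intro mult_left_mono) auto
  also have "\<dots> = 4 * s" using assms by (simp add: mult.assoc)
  finally show ?thesis .
qed

lemma n_over_lambda_bounds:
  assumes "k \<ge> 2" "r \<ge> 1"
  shows "real r \<le> n_over_lambda k (k * r)" "n_over_lambda k (k * r) \<le> 2 * real r"
  using assms by (simp_all add: n_over_lambda_def divide_le_eq le_divide_eq algebra_simps)

lemma card_core_pos: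
  assumes "f \<in> zero_k_mappings k n" "n \<ge> 1"
  shows "1 \<le> card (core n f)"
  using rho_cycle_le_card_core[OF assms(1), of 1] assms(2) by simp

text \<open>Upward, \<open>ln (Z / s) <= Z / s\<close>, and the mean of \<open>Z\<close> is at most
  \<open>3 s / 2\<close>. Downward, the decreasing weight \<open>max 0 (ln (s / j))\<close> has
  total at most \<open>4 s\<close>, which leads to 12 as the product of 4, \<open>3 / 2\<close> and
  the bound 2 on \<open>s^2 / r\<close>. The sum \<open>3 / 2 + 12\<close> is rounded up to
  14.\<close>

lemma sum_ln_core_deviation_le:
  fixes k r :: nat
  defines "n \<equiv> k * r"
  defines "M \<equiv> zero_k_mappings k n"
  assumes k: "k \<ge> 2" and r: "r \<ge> 1"
  shows "(\<Sum>f\<in>M. \<bar>ln (real (card (core n f))) - ln (sqrt (n_over_lambda k n))\<bar>) \<le> 14 * real (card M)"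
proof -
  define s where "s = sqrt (n_over_lambda k n)"
  define Z where "Z = (\<lambda>f. real (card (core n f)))"
  define N where "N = real (card M)"
  define w where "w = (\<lambda>j :: nat. max 0 (ln (s / real j)))"
  have bounds: "real r \<le> n_over_lambda k n" "n_over_lambda k n \<le> 2 * real r"
    using n_over_lambda_bounds[OF k r] by (simp_all add: n_def)
  have s2: "s ^ 2 = n_over_lambda k n" using bounds r by (simp add: s_def)
  have s: "s > 0" using bounds r by (simp add: s_def)
  have n: "n \<ge> 1" using k r by (simp add: n_def)
  have lam: "real k - 1 > 0" using k by simp
  have Z1: "Z f \<ge> 1" if "f \<in> M" for f
    using card_core_pos[of f k n] that n by (simp add: Z_def M_def)
  have "(real k - 1) * (\<Sum>f\<in>M. Z f * (Z f + 1) / 2) \<le> real n * N"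
    using sum_core_sq_le[of k n] k by (simp add: Z_def N_def M_def)
  then have "(\<Sum>f\<in>M. Z f * (Z f + 1) / 2) \<le> s ^ 2 * N"
    using lam by (simp add: s2 n_over_lambda_def field_simps)
  moreover have "(\<Sum>f\<in>M. Z f ^ 2) / 2 \<le> (\<Sum>f\<in>M. Z f * (Z f + 1) / 2)"
    unfolding sum_divide_distrib using Z1
    by (intro sum_mono) (auto simp: power2_eq_square algebra_simps intro: order_trans[OF zero_le_one])
  ultimately have sumZ2: "(\<Sum>f\<in>M. Z f ^ 2) \<le> 2 * s ^ 2 * N" by simp
  have sumZ: "(\<Sum>f\<in>M. Z f) \<le> 3 / 2 * s * N"
  proof -
    \<comment> \<open>Arithmetic-geometric mean inequality, balanced at \<open>Z = s\<close>, in
      place of Cauchy-Schwarz.\<close>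
    have "Z f \<le> (1 / (2 * s)) * Z f ^ 2 + s / 2" for f
      using zero_le_power2[of "Z f - s"] s by (simp add: power2_diff field_simps power2_eq_square)
    then have "(\<Sum>f\<in>M. Z f) \<le> (\<Sum>f\<in>M. (1 / (2 * s)) * Z f ^ 2 + s / 2)"
      by (intro sum_mono)
    also have "\<dots> = (1 / (2 * s)) * (\<Sum>f\<in>M. Z f ^ 2) + N * (s / 2)"
      by (simp add: sum.distrib sum_distrib_left N_def)
    also have "\<dots> \<le> (1 / (2 * s)) * (2 * s ^ 2 * N) + N * (s / 2)"
      using sumZ2 s by (intro add_right_mono mult_left_mono) auto
    also have "\<dots> = 3 / 2 * s * N" using s by (simp add: field_simps power2_eq_square)
    finally show ?thesis .
  qed
  have sumw: "(\<Sum>f\<in>M. w (card (core n f))) \<le> 12 * N"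
  proof -
    have anti: "w j \<le> w i" if "1 \<le> i" "i \<le> j" for i j
      using that s unfolding w_def by (intro max.mono ln_mono divide_left_mono order_refl) auto
    have "real n * (\<Sum>f\<in>M. w (card (core n f))) \<le> (\<Sum>j=1..n. w j) * (real k * (\<Sum>f\<in>M. Z f))"
      unfolding M_def Z_def by (rule sum_antimono_core_le[OF anti]) (auto simp: w_def)
    also have "\<dots> \<le> (4 * s) * (real k * (3 / 2 * s * N))"
    proof (intro mult_mono mult_left_mono sumZ)
      show "(\<Sum>j=1..n. w j) \<le> 4 * s" unfolding w_def by (rule sum_ln_pos_part_le[OF s])
      show "0 \<le> real k * (\<Sum>f\<in>M. Z f)" by (intro mult_nonneg_nonneg sum_nonneg) (auto simp: Z_def)
    qed (use s in \<open>auto simp: Z_def intro!: sum_nonneg\<close>)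
    also have "\<dots> = real k * (6 * s ^ 2 * N)" by (simp add: power2_eq_square)
    finally have "real r * (\<Sum>f\<in>M. w (card (core n f))) \<le> 6 * s ^ 2 * N"
      using k by (simp add: n_def mult.assoc)
    also have "\<dots> \<le> 6 * (2 * real r) * N"
      using bounds s2 by (intro mult_right_mono mult_left_mono) (auto simp: N_def)
    finally have "real r * (\<Sum>f\<in>M. w (card (core n f))) \<le> real r * (12 * N)" by simp
    then show ?thesis using r by simp
  qed
  have "(\<Sum>f\<in>M. \<bar>ln (Z f) - ln s\<bar>) \<le> (\<Sum>f\<in>M. 1 / s * Z f + w (card (core n f)))"
  proof (rule sum_mono)
    fix f assume "f \<in> M"
    then have Z: "Z f > 0" using Z1[of f] by simp
    have w: "w (card (core n f)) = max 0 (ln s - ln (Z f))"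
      using Z s by (simp add: w_def Z_def ln_div)
    have "0 < Z f / s" using Z s by simp
    from ln_less_self[OF this] have "ln (Z f / s) \<le> Z f / s" by linarith
    then have "ln (Z f) - ln s \<le> 1 / s * Z f" using Z s by (simp add: ln_div)
    moreover have "0 \<le> 1 / s * Z f" using Z s by simp
    ultimately show "\<bar>ln (Z f) - ln s\<bar> \<le> 1 / s * Z f + w (card (core n f))"
      unfolding w by linarith
  qed
  also have "\<dots> = 1 / s * (\<Sum>f\<in>M. Z f) + (\<Sum>f\<in>M. w (card (core n f)))"
    by (simp only: sum.distrib sum_distrib_left)
  also have "\<dots> \<le> 1 / s * (3 / 2 * s * N) + 12 * N"
    using sumZ sumw s by (intro add_mono mult_left_mono) auto
  also have "\<dots> = (3 / 2 + 12) * N" using s by (simp add: field_simps)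
  also have "\<dots> \<le> 14 * N" by (intro mult_right_mono) (auto simp: N_def)
  finally show ?thesis by (simp only: Z_def N_def s_def)
qed

section \<open>Smoothing and the choice of its scale\<close>

text \<open>The ramp \<open>h\<close> is 1 up to \<open>x\<close> and 0 from \<open>x + e\<close>.
  The constant is \<open>5856 * 8 * 15\<close>, where 8 bounds \<open>e (1 + \<kappa>)\<close> and
  15 is \<open>1 + 14\<close>, with 14 from the mean deviation of \<open>ln Z\<close>.\<close>

lemma smoothed_normal_approximation:
  fixes k r :: nat and x e :: real
  defines "n \<equiv> k * r"
  defines "M \<equiv> zero_k_mappings k n" and "ell \<equiv> ln (sqrt (n_over_lambda k n))"
    and "h \<equiv> \<lambda>y. min 1 (max 0 ((x + e - y) / e))"
  assumes k: "k \<ge> 2" and r: "r \<ge> 1" and ell: "ell \<ge> 1" and e: "0 < e" "e \<le> 1"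
  shows "\<bar>(\<Sum>f\<in>M. h (Y_n k n f)) - real (card M) * (\<integral>y. h y * std_normal_density y \<partial>lborel)\<bar>
    \<le> 702720 * real (card M) / (e * sqrt ell)"
proof -
  define t where "t = sqrt ell"
  \<comment> \<open>An increment of \<open>g' y = y g y + h y - \<theta>\<close> over a step
    \<open>u\<close> has three parts: at most \<open>6 u\<close> from \<open>u g\<close>,
    \<open>2 |y| u\<close> from the increment of \<open>g\<close>, and \<open>u / e\<close> from
    \<open>h\<close>. The first and the last make up \<kappa>.\<close>
  define \<kappa> where "\<kappa> = 6 + 1 / e"
  define V where "V = (\<lambda>w. (w - t ^ 4 / 2) / (t ^ 3 / sqrt 3))"
  define D where "D = (\<lambda>f. \<bar>ln (real (card (core n f))) - ell\<bar>)"
  define N where "N = real (card M)"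
  define \<theta> where "\<theta> = (\<integral>y. h y * std_normal_density y \<partial>lborel)"
  have t: "t \<ge> 1" "t ^ 2 = ell" using ell by (auto simp: t_def)
  have t4: "t ^ 4 = ell ^ 2" by (simp flip: t(2) power_mult)
  have sigma: "sigma_n k n = t ^ 3 / sqrt 3"
  proof -
    have "sigma_n k n = sqrt (ell ^ 3) / sqrt 3" by (simp add: sigma_n_def ell_def real_sqrt_divide)
    also have "sqrt (ell ^ 3) = t ^ 3" by (simp add: t_def real_sqrt_power)
    finally show ?thesis .
  qed
  have Y: "Y_n k n f = V (ln (real (cycle_product n f)))" for f
    by (simp add: Y_n_def V_def sigma mu_n_def t4 flip: ell_def)
  have hlip: "\<bar>h u - h v\<bar> \<le> \<bar>u - v\<bar> / e" for u v
  proof -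
    have "\<bar>h u - h v\<bar> \<le> \<bar>(x + e - u) / e - (x + e - v) / e\<bar>" unfolding h_def by linarith
    also have "\<dots> = \<bar>u - v\<bar> / e" using e by (simp add: abs_minus_commute flip: diff_divide_distrib)
    finally show ?thesis .
  qed
  have hcont: "continuous_on UNIV h" unfolding h_def using e by (intro continuous_intros) auto
  have h01: "0 \<le> h y" "h y \<le> 1" for y by (auto simp: h_def)
  obtain g g' where deriv: "\<And>x. (g has_real_derivative g' x) (at x)" and ode: "\<And>x. g' x = x * g x + h x - \<theta>"
    and c0: "\<And>x. \<bar>g x\<bar> \<le> 6" and c1: "\<And>x. \<bar>g' x\<bar> \<le> 2"
    using stein_solution[OF hcont h01] unfolding \<theta>_def by blast
  have mod: "\<bar>g' (y + u) - g' y\<bar> \<le> u * (\<kappa> + 2 * \<bar>y\<bar>)" if "u \<ge> 0" for y u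
  proof -
    have "\<bar>g (y + u) - g y\<bar> \<le> 2 * u"
      using field_differentiable_bound[of UNIV g g' 2 "y + u" y] deriv c1 that by auto
    then have "\<bar>y * (g (y + u) - g y)\<bar> \<le> \<bar>y\<bar> * (2 * u)"
      unfolding abs_mult by (intro mult_left_mono) auto
    moreover have "\<bar>u * g (y + u)\<bar> \<le> u * 6"
      unfolding abs_mult using that c0 by (intro mult_mono) auto
    moreover have "\<bar>h (y + u) - h y\<bar> \<le> u / e" using hlip[of "y + u" y] that by simp
    moreover have "g' (y + u) - g' y = u * g (y + u) + y * (g (y + u) - g y) + (h (y + u) - h y)"
      by (simp add: ode algebra_simps)
    moreover have "u * (\<kappa> + 2 * \<bar>y\<bar>) = u * 6 + \<bar>y\<bar> * (2 * u) + u / e"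
      by (simp add: \<kappa>_def algebra_simps)
    ultimately show ?thesis by linarith
  qed
  have each: "\<bar>cexp (card (core n f)) (\<lambda>w. h (V w)) - \<theta>\<bar> \<le> 5856 * (1 + D f) * (1 + \<kappa>) / t" if f: "f \<in> M" for f
  proof -
    define m where "m = card (core n f)"
    have n1: "n \<ge> 1" using k r by (simp add: n_def)
    have m: "1 \<le> m" "m \<le> r"
      using card_core_pos[of f k n] card_core_le[of f k r] f k n1 by (auto simp: m_def M_def n_def)
    \<comment> \<open>Counting fibres gives \<open>Z <= r <= n / \<lambda>\<close>, so
      \<open>ln Z\<close> is at most \<open>2 ell\<close> for every mapping, as the Stein estimate
      requires.\<close>
    have "ln (real m) \<le> ln (real r)" using m by simp
    also have "\<dots> \<le> ln (n_over_lambda k n)"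
      using n_over_lambda_bounds(1)[OF k r] r by (simp add: n_def)
    also have "\<dots> = 2 * t ^ 2"
      using n_over_lambda_bounds(1)[OF k r] r by (simp add: t(2) ell_def n_def ln_sqrt)
    finally have Lt: "ln (real m) \<le> 2 * t ^ 2" .
    have "cexp m (\<lambda>w. h (V w)) = cexp m (\<lambda>w. (g' (V w) - V w * g (V w)) + \<theta>)"
      by (simp add: ode)
    then have "cexp m (\<lambda>w. h (V w)) - \<theta> = - (cexp m (\<lambda>w. V w * g (V w)) - cexp m (\<lambda>w. g' (V w)))"
      by (simp only: cexp_add cexp_diff cexp_const)
    also have "\<bar>\<dots>\<bar> \<le> 5856 * (1 + \<bar>ln (real m) - t ^ 2\<bar>) * (1 + \<kappa>) / t"
      unfolding abs_minus_cancel V_def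
      by (rule cexp_stein_bound[OF m(1) t(1) Lt _ deriv c0 c1 mod]) (use e in \<open>auto simp: \<kappa>_def\<close>)
    finally show ?thesis by (simp only: m_def D_def t(2))
  qed
  have "(\<Sum>f\<in>M. h (Y_n k n f)) = (\<Sum>f\<in>M. cexp (card (core n f)) (\<lambda>w. h (V w)))"
    unfolding Y M_def by (rule sum_mappings_log_cycle_product)
  then have "\<bar>(\<Sum>f\<in>M. h (Y_n k n f)) - N * \<theta>\<bar> = \<bar>\<Sum>f\<in>M. cexp (card (core n f)) (\<lambda>w. h (V w)) - \<theta>\<bar>"
    by (simp add: sum_subtractf N_def)
  also have "\<dots> \<le> (\<Sum>f\<in>M. 5856 * (1 + D f) * (1 + \<kappa>) / t)"
    by (rule order_trans[OF sum_abs]) (rule sum_mono, rule each)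
  also have "\<dots> = 5856 * (1 + \<kappa>) / t * (N + (\<Sum>f\<in>M. D f))"
  proof -
    have "(\<Sum>f\<in>M. 5856 * (1 + D f) * (1 + \<kappa>) / t) = (\<Sum>f\<in>M. 5856 * (1 + \<kappa>) / t * (1 + D f))"
      by (rule sum.cong[OF refl]) (simp only: times_divide_eq_left times_divide_eq_right mult_ac)
    then show ?thesis by (simp only: sum_distrib_left[symmetric] sum.distrib) (simp add: N_def)
  qed
  also have "\<dots> \<le> 5856 * (8 / e) / t * (N + 14 * N)"
  proof (rule mult_mono)
    have "1 \<le> 1 / e" using e by simp
    then have "1 + \<kappa> \<le> 8 / e" unfolding \<kappa>_def using e by (simp add: field_simps)
    then show "5856 * (1 + \<kappa>) / t \<le> 5856 * (8 / e) / t" using t by (intro divide_right_mono) auto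
    show "N + (\<Sum>f\<in>M. D f) \<le> N + 14 * N"
      using sum_ln_core_deviation_le[OF k r] by (simp add: N_def M_def D_def ell_def n_def)
    show "0 \<le> N + (\<Sum>f\<in>M. D f)" by (intro add_nonneg_nonneg sum_nonneg) (auto simp: N_def D_def)
  qed (use t e in auto)
  also have "\<dots> = 702720 * N / (e * t)" by simp
  finally show ?thesis by (simp only: N_def \<theta>_def t_def)
qed

text \<open>With \<open>e = ell^(-1/4)\<close> the smoothed error \<open>1 / (e sqrt ell)\<close>
  equals \<open>e\<close>. The indicator lies between the ramps starting at \<open>x - e\<close> and
  at \<open>x\<close>; as \<open>phi\<close> is 1-Lipschitz, this costs one more \<open>e\<close>,
  hence \<open>702720 + 1\<close>.\<close>

lemma kolmogorov_distance_log_cycle_product: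
  fixes k r :: nat and x :: real
  defines "n \<equiv> k * r"
  defines "ell \<equiv> ln (sqrt (n_over_lambda k n))"
  assumes k: "k \<ge> 2" and r: "r \<ge> 1" and ell: "ell \<ge> 1"
  shows "\<bar>measure_pmf.prob (zero_k_pmf k n) {f. Y_n k n f \<le> x} - phi x\<bar> \<le> 702721 / ell powr (1 / 4)"
proof -
  define M where "M = zero_k_mappings k n"
  define N where "N = real (card M)"
  define q where "q = ell powr (1 / 4)"
  define e where "e = 1 / q"
  define h where "h = (\<lambda>x y. min 1 (max 0 ((x + e - y) / e)))"
  define P where "P = measure_pmf.prob (zero_k_pmf k n) {f. Y_n k n f \<le> x}"
  have q: "q \<ge> 1" unfolding q_def using ell by (intro ge_one_powr_ge_zero) auto
  have q2: "sqrt ell = q ^ 2" using ell by (simp add: q_def powr_half_sqrt[symmetric] power2_eq_square powr_add[symmetric])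
  have e: "0 < e" "e \<le> 1" using q by (auto simp: e_def)
  have M: "finite M" "M \<noteq> {}" using zero_k_mappings_nonempty[of k r] k by (auto simp: M_def n_def)
  have N: "N > 0" using M by (simp add: N_def card_gt_0_iff)
  have P: "N * P = (\<Sum>f\<in>M. indicator {..x} (Y_n k n f))"
  proof -
    have "P = real (card (M \<inter> {f. Y_n k n f \<le> x})) / N"
      unfolding P_def zero_k_pmf_def M_def[symmetric] N_def by (rule measure_pmf_of_set[OF M(2,1)])
    moreover have "(\<Sum>f\<in>M. indicator {..x} (Y_n k n f)) = real (card (M \<inter> {f. Y_n k n f \<le> x}))"
      using M(1) sum.inter_restrict[OF M(1), of "\<lambda>_. 1 :: real" "{f. Y_n k n f \<le> x}"]
      by (simp add: indicator_def of_bool_def)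
    ultimately show ?thesis using N by simp
  qed
  have approx: "\<bar>(\<Sum>f\<in>M. h z (Y_n k n f)) - N * (\<integral>y. h z y * std_normal_density y \<partial>lborel)\<bar> \<le> N * (702720 * e)" for z
  proof -
    have "702720 * N / (e * sqrt ell) = N * (702720 * e)"
      using q by (simp add: q2 e_def power2_eq_square)
    then show ?thesis
      using smoothed_normal_approximation[OF k r _ e, of z] ell
      unfolding h_def M_def N_def n_def ell_def by simp
  qed
  have hbounds: "indicator {..z} y \<le> h z y" "h z y \<le> indicator {..z + e} y" for z y
    using e by (auto simp: h_def indicator_def divide_le_0_iff)
  have meas: "h z \<in> borel_measurable borel" for z unfolding h_def by measurable
  note \<theta> = integral_between_phi[OF meas hbounds]
  have "N * P \<le> (\<Sum>f\<in>M. h x (Y_n k n f))"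
    unfolding P by (intro sum_mono hbounds)
  also have "\<dots> \<le> N * (\<integral>y. h x y * std_normal_density y \<partial>lborel) + N * (702720 * e)"
    using approx[of x] by linarith
  also have "\<dots> \<le> N * (phi x + e) + N * (702720 * e)"
    using \<theta>(2)[of x] phi_diff_le[of e x] e N by (intro add_right_mono mult_left_mono) auto
  also have "\<dots> = N * (phi x + 702721 * e)" by (simp add: algebra_simps)
  finally have upper: "P \<le> phi x + 702721 * e" using N by simp
  have "N * (phi x - e) \<le> N * (\<integral>y. h (x - e) y * std_normal_density y \<partial>lborel)"
    using \<theta>(1)[of "x - e"] phi_diff_le[of e "x - e"] e N by (intro mult_left_mono) auto
  also have "\<dots> \<le> (\<Sum>f\<in>M. h (x - e) (Y_n k n f)) + N * (702720 * e)"
    using approx[of "x - e"] by linarith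
  also have "\<dots> \<le> N * P + N * (702720 * e)"
    unfolding P using hbounds(2)[of "x - e"] by (intro add_right_mono sum_mono) simp
  also have "\<dots> = N * (P + 702720 * e)" by (simp add: algebra_simps)
  finally have "phi x - e \<le> P + 702720 * e" using N by simp
  then show ?thesis using upper unfolding P_def e_def q_def by (simp add: abs_le_iff)
qed

theorem theorem5p5:
  fixes k n :: "nat \<Rightarrow> nat" and \<alpha> :: real
  assumes "\<And>r. r \<ge> 1 \<Longrightarrow> k r \<ge> 2"
    and "\<And>r. r \<ge> 1 \<Longrightarrow> n r = k r * r"
    and "0 < \<alpha>" and "\<alpha> < 1"
    and "(\<lambda>r. real (k r)) \<in> o(\<lambda>r. real (n r) powr (1 - \<alpha>))"
  shows "weak_conv_m (\<lambda>r. distr (measure_pmf (zero_k_pmf (k r) (n r))) borel (Y_n (k r) (n r)))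
           std_normal_distribution \<and>
         (\<exists>E1 E2 :: nat \<times> real \<Rightarrow> real.
           (\<forall>r\<ge>1. \<forall>x.
              measure_pmf.prob (zero_k_pmf (k r) (n r))
                {f. ln (real (cycle_product (n r) f)) \<le> mu_n (k r) (n r) + x * sigma_n (k r) (n r)}
              = phi x + E1 (r, x) + E2 (r, x)) \<and>
           E1 \<in> O[sequentially \<times>\<^sub>F top](\<lambda>(r, x).
              \<bar>x\<bar> / ln (sqrt (n_over_lambda (k r) (n r))) powr (3 / 4)) \<and>
           E2 \<in> O[sequentially \<times>\<^sub>F top](\<lambda>(r, x).
              (ln (ln (real (n r)))) ^ 2 / ln (n_over_lambda (k r) (n r)) powr (1 / 4)))"
proof -
  define ell where "ell = (\<lambda>r. ln (sqrt (n_over_lambda (k r) (n r))))"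
  define C :: real where "C = 702721"
  have ell_ge: "ln (real r) / 2 \<le> ell r" if "r \<ge> 1" for r
  proof -
    have "real r \<le> n_over_lambda (k r) (n r)"
      using n_over_lambda_bounds(1)[OF assms(1)[OF that] that] assms(2)[OF that] by simp
    then show ?thesis using that by (simp add: ell_def ln_sqrt)
  qed
  have ell_lim: "filterlim ell at_top sequentially"
  proof (rule filterlim_at_top_mono)
    show "filterlim (\<lambda>r. ln (real r) / 2) at_top sequentially" by real_asymp
    show "\<forall>\<^sub>F r in sequentially. ln (real r) / 2 \<le> ell r"
      using eventually_ge_at_top[of 1] by eventually_elim (rule ell_ge)
  qed
  then have evell: "\<forall>\<^sub>F r in sequentially. ell r \<ge> 1" by (simp add: filterlim_at_top)
  have dist: "\<bar>measure_pmf.prob (zero_k_pmf (k r) (n r)) {f. Y_n (k r) (n r) f \<le> x} - phi x\<bar>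
      \<le> C / ell r powr (1 / 4)" if "r \<ge> 1" "ell r \<ge> 1" for r x
    using kolmogorov_distance_log_cycle_product[OF assms(1)[OF that(1)] that(1), of x] that(2) assms(2)[OF that(1)]
    by (simp add: C_def ell_def)
  have event: "{f. ln (real (cycle_product (n r) f)) \<le> mu_n (k r) (n r) + x * sigma_n (k r) (n r)}
      = {f. Y_n (k r) (n r) f \<le> x}" if "ell r \<ge> 1" for r x
  proof -
    have "sigma_n (k r) (n r) > 0" using that by (simp add: sigma_n_def ell_def)
    then show ?thesis by (auto simp: Y_n_def divide_le_eq)
  qed
  have "weak_conv_m (\<lambda>r. distr (measure_pmf (zero_k_pmf (k r) (n r))) borel (Y_n (k r) (n r)))
           std_normal_distribution"
    unfolding weak_conv_m_def weak_conv_def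
  proof (intro allI impI)
    fix x
    let ?P = "\<lambda>r. cdf (distr (measure_pmf (zero_k_pmf (k r) (n r))) borel (Y_n (k r) (n r))) x"
    have P: "?P r = measure_pmf.prob (zero_k_pmf (k r) (n r)) {f. Y_n (k r) (n r) f \<le> x}" for r
      by (simp add: cdf_def measure_distr vimage_def)
    have "(\<lambda>r. ?P r - phi x) \<longlonglongrightarrow> 0"
    proof (rule Lim_null_comparison)
      show "\<forall>\<^sub>F r in sequentially. norm (?P r - phi x) \<le> C / ell r powr (1 / 4)"
        using eventually_ge_at_top[of 1] evell by eventually_elim (simp add: P dist)
      have "filterlim (\<lambda>y::real. y powr (1 / 4)) at_top at_top" by real_asymp
      from filterlim_compose[OF this ell_lim]
      show "(\<lambda>r. C / ell r powr (1 / 4)) \<longlonglongrightarrow> 0"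
        by (rule real_tendsto_divide_at_top[OF tendsto_const])
    qed
    then show "?P \<longlonglongrightarrow> cdf std_normal_distribution x"
      by (simp add: cdf_std_normal_distribution LIM_zero_iff)
  qed
  \<comment> \<open>The whole deviation goes into \<open>E2\<close>, with \<open>E1 = 0\<close>: the
    Kolmogorov bound is uniform in \<open>x\<close> and, once \<open>ln (ln r) >= 1\<close>, it lies
    within a constant multiple of the second error term.\<close>
  moreover define E2 where "E2 = (\<lambda>(r, x). measure_pmf.prob (zero_k_pmf (k r) (n r))
      {f. ln (real (cycle_product (n r) f)) \<le> mu_n (k r) (n r) + x * sigma_n (k r) (n r)} - phi x)"
  have "E2 \<in> O[sequentially \<times>\<^sub>F top](\<lambda>(r, x).
              (ln (ln (real (n r)))) ^ 2 / ln (n_over_lambda (k r) (n r)) powr (1 / 4))"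
  proof (rule bigoI)
    have "\<forall>\<^sub>F r in sequentially. 1 \<le> ln (ln (real r))" by real_asymp
    then have "\<forall>\<^sub>F r in sequentially. \<forall>x. norm (E2 (r, x)) \<le> (2 * C) *
        norm ((ln (ln (real (n r)))) ^ 2 / ln (n_over_lambda (k r) (n r)) powr (1 / 4))"
      using eventually_ge_at_top[of 2] evell
    proof eventually_elim
      case (elim r)
      show ?case
      proof
        fix x
        have r: "r \<ge> 1" using elim by simp
        have "r \<le> n r" using assms(1)[OF r] assms(2)[OF r] by simp
        then have "ln (real r) \<le> ln (real (n r))" "0 < ln (real r)" using elim by auto
        then have "1 \<le> ln (ln (real (n r)))" using elim ln_mono[of "ln (real r)" "ln (real (n r))"] by linarith
        then have ll: "1 \<le> (ln (ln (real (n r)))) ^ 2" by simp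
        have "real r \<le> n_over_lambda (k r) (n r)"
          using n_over_lambda_bounds(1)[OF assms(1)[OF r] r] assms(2)[OF r] by simp
        then have ln2: "ln (n_over_lambda (k r) (n r)) = 2 * ell r"
          using r by (simp add: ell_def ln_sqrt)
        \<comment> \<open>As \<open>ln (n / \<lambda>) = 2 ell\<close>, comparing fourth roots
          accounts for the factor 2 in \<open>2 * C\<close>.\<close>
        have "(2 * ell r) powr (1 / 4) = 2 powr (1 / 4) * ell r powr (1 / 4)"
          using elim by (simp add: powr_mult)
        also have "\<dots> \<le> 2 * ell r powr (1 / 4)"
          using powr_mono[of "1 / 4" 1 "2 :: real"] by (intro mult_right_mono) auto
        finally have pow: "(2 * ell r) powr (1 / 4) \<le> 2 * ell r powr (1 / 4)" .
        have pos: "0 < (2 * ell r) powr (1 / 4)" "0 < ell r powr (1 / 4)" using elim by auto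
        have "norm (E2 (r, x)) \<le> C / ell r powr (1 / 4)"
          using dist[OF r] elim event by (simp add: E2_def)
        also have "\<dots> \<le> 2 * C * 1 / (2 * ell r) powr (1 / 4)"
          using pow pos by (simp add: divide_simps C_def)
        also have "\<dots> \<le> 2 * C * (ln (ln (real (n r)))) ^ 2 / (2 * ell r) powr (1 / 4)"
          using ll pos by (intro divide_right_mono mult_left_mono) (auto simp: C_def)
        finally show "norm (E2 (r, x)) \<le> (2 * C) *
            norm ((ln (ln (real (n r)))) ^ 2 / ln (n_over_lambda (k r) (n r)) powr (1 / 4))"
          unfolding ln2 by simp
      qed
    qed
    then show "\<forall>\<^sub>F z in sequentially \<times>\<^sub>F top. norm (E2 z) \<le> (2 * C) * norm (case z of (r, x) \<Rightarrow>
        (ln (ln (real (n r)))) ^ 2 / ln (n_over_lambda (k r) (n r)) powr (1 / 4))"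
      unfolding eventually_prod_filter
      by (intro exI[of _ "\<lambda>r. \<forall>x. norm (E2 (r, x)) \<le> (2 * C) *
        norm ((ln (ln (real (n r)))) ^ 2 / ln (n_over_lambda (k r) (n r)) powr (1 / 4))"] exI[of _ "\<lambda>_. True"]) auto
  qed
  moreover have "\<forall>r\<ge>1. \<forall>x. measure_pmf.prob (zero_k_pmf (k r) (n r))
      {f. ln (real (cycle_product (n r) f)) \<le> mu_n (k r) (n r) + x * sigma_n (k r) (n r)}
      = phi x + (\<lambda>_. 0) (r, x) + E2 (r, x)"
    by (simp add: E2_def)
  moreover have "(\<lambda>_. 0 :: real) \<in> O[sequentially \<times>\<^sub>F top](\<lambda>(r, x :: real).
      \<bar>x\<bar> / ln (sqrt (n_over_lambda (k r) (n r))) powr (3 / 4))"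
    by simp
  ultimately show ?thesis by (intro conjI exI[of _ "\<lambda>_. 0"] exI[of _ E2])
qed

end
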